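(* Let $(X,d)$ be a compact metric space, $\Sigma=\{\alpha_n : n\in\mathbb{Z}^\ast\}$ an alphabet, $\vec k=(k_n)_{n\in\mathbb{Z}^\ast}\subseteq\mathbb{N}$ such that $(k_n)_{n\in\mathbb{N}}$ and $(k_{-n})_{n\in\mathbb{N}}$ are increasing sequences, and $\upsilon\notin\Sigma$. (a) Let $\vec w\in\widetilde L^\infty(\Sigma,\vec k;\upsilon)$. For every family $\{x_w\}_{w\in\widetilde L(\Sigma,\vec k)}\subseteq X$ there exist an extraction $\vec u\prec\vec w$ and $x_0\in X$ such that $R_1\text{-}\lim_{w\in\widetilde E(\vec u)}x_w=x_0$. (b) Let $\vec w\in L^\infty(\Sigma,\vec k;\upsilon)$. For every family $\{x_w\}_{w\in L(\Sigma,\vec k)}\subseteq X$ there exist an extraction $\vec u\prec\vec w$ and $x_0\in X$ such that $R_2\text{-}\lim_{w\in E(\vec u)}x_w=x_0$.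
   Context: Notation: $\mathbb{N}=\{1,2,\ldots\}$, $\mathbb{Z}^\ast=\mathbb{Z}\setminus\{0\}$. "Increasing" is in the weak sense (constant sequences allowed). The letters $\alpha_n$ need not be distinct. $\upsilon\notin\Sigma$ is called a variable. Two-sided words. $\widetilde L(\Sigma,\vec k)$ is the set of functions $w$ from a nonempty finite set $dom(w)\subset\mathbb{Z}^\ast$ to $\Sigma$ with $w(n)\in\{\alpha_1,\ldots,\alpha_{k_n}\}$ for $n\in dom(w)$, $n>0$, and $w(n)\in\{\alpha_{-k_n},\ldots,\alpha_{-1}\}$ for $n\in dom(w)$, $n<0$. A variable word is a function $w$ from a nonempty finite $dom(w)\subset\mathbb{Z}^\ast$ to $\Sigma\cup\{\upsilon\}$ such that, for each $n\in dom(w)$, $w(n)\in\{\upsilon,\alpha_1,\ldots,\alpha_{k_n}\}$ if $n>0$ and $w(n)\in\{\upsilon,\alpha_{-k_n},\ldots,\alpha_{-1}\}$ if $n<0$, and $\upsilon$ is attained. Put $dom^-(w)=\{n\in dom(w):n<0\}$, $dom^+(w)=\{n\in dom(w):n>0\}$. $\widetilde L_0(\Sigma,\vec k;\upsilon)$ is the set of variable words taking the value $\upsilon$ at some element of $dom^-(w)$ and at some element of $dom^+(w)$. For words $w,u$ (variable or not) with disjoint domains, $w\star u$ is the word with domain $dom(w)\cup dom(u)$ extending both. $w<_{R_1}u$ means $dom(u)=A_1\cup A_2$ with $A_1,A_2\ne\emptyset$ and $\max A_1<\min dom(w)\le\max dom(w)<\min A_2$. $\widetilde L^\infty(\Sigma,\vec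 k;\upsilon)$ is the set of sequences $(w_n)_{n\in\mathbb{N}}$ in $\widetilde L_0(\Sigma,\vec k;\upsilon)$ with $w_n<_{R_1}w_{n+1}$ for all $n$. Substitution: for $w\in\widetilde L_0(\Sigma,\vec k;\upsilon)$ with $n_w=\min dom^+(w)$, $-m_w=\max dom^-(w)$, and $1\le p\le k_{n_w}$, $1\le q\le k_{-m_w}$, $w(p,q)$ is obtained from $w$ by replacing $\upsilon$ by $\alpha_p$ at positive positions and by $\alpha_{-q}$ at negative positions; $w(\upsilon,\upsilon)=w$. (For $\vec w\in\widetilde L^\infty(\Sigma,\vec k;\upsilon)$, $w_n(p,q)$ is defined whenever $p\le k_n$, $q\le k_{-n}$.) Extractions: for $\vec w=(w_n)\in\widetilde L^\infty(\Sigma,\vec k;\upsilon)$, $\widetilde E(\vec w)$ is the set of words $w_{n_1}(p_1,q_1)\star\cdots\star w_{n_\lambda}(p_\lambda,q_\lambda)$ with $\lambda\in\mathbb{N}$, $n_1<\cdots<n_\lambda$ in $\mathbb{N}$, $(p_i,q_i)\in\{1,\ldots,k_{n_i}\}\times\{1,\ldots,k_{-n_i}\}$. $\widetilde{EV}(\vec w)$ is the set of words of the same form where $(p_i,q_i)\in(\{1,\ldots,k_{n_i}\}\times\{1,\ldots,k_{-n_i}\})\cup\{(\upsilon,\upsilon)\}$ and at least one $(p_i,q_i)=(\upsilon,\upsilon)$. $\vec u\prec\vec w$ ("$\vec u$ is an extraction of $\vec w$") means $\vec u\in\widetilde L^\infty(\Sigma,\vec k;\upsilon)$ and $u_n\in\widetilde{EV}(\vec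 w)$ for all $n$. One-sided words (only indices $n\in\mathbb{N}$ of $\Sigma,\vec k$ matter). $L(\Sigma,\vec k)$ is the set of $w\in\widetilde L(\Sigma,\vec k)$ with $dom(w)\subset\mathbb{N}$; $L(\Sigma,\vec k;\upsilon)$ is the set of variable words with domain in $\mathbb{N}$. $w<_{R_2}u$ means $\max dom(w)<\min dom(u)$. $L^\infty(\Sigma,\vec k;\upsilon)$ is the set of sequences $(w_n)_{n\in\mathbb{N}}$ in $L(\Sigma,\vec k;\upsilon)$ with $w_n<_{R_2}w_{n+1}$. For $1\le p\le k_{\min dom(w)}$, $w(p)$ is $w$ with $\upsilon$ replaced by $\alpha_p$; $w(\upsilon)=w$. $E(\vec w)$ is the set of words $w_{n_1}(p_1)\star\cdots\star w_{n_\lambda}(p_\lambda)$ with $n_1<\cdots<n_\lambda$, $1\le p_i\le k_{n_i}$; $EV(\vec w)$ is the same with $p_i\in\{1,\ldots,k_{n_i}\}\cup\{\upsilon\}$ and some $p_i=\upsilon$. $\vec u\prec\vec w$ means $\vec u\in L^\infty(\Sigma,\vec k;\upsilon)$ and $u_n\in EV(\vec w)$ for all $n$. Convergence. $R_1\text{-}\lim_{w\in\widetilde E(\vec u)}x_w=x_0$ means: for every neighborhood $V$ of $x_0$ there is $n_0\in\mathbb{N}$ such that $x_w\in V$ for all $w\in\widetilde E(\vec u)$ with $\min\{-\max dom^-(w),\min dom^+(w)\}\ge n_0$. $R_2\text{-}\lim_{w\in E(\vec u)}x_w=x_0$ means: for every neighborhood $V$ of $x_0$ there is $n_0$ such that $x_w\in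 V$ for all $w\in E(\vec u)$ with $\min dom(w)\ge n_0$. *)

theory Defs
  imports "HOL-Analysis.Analysis"
begin

text \<open>
  Conventions. The set of natural numbers of the source is \<open>{1, 2, \<dots>}\<close>; sequences indexed
  by it are functions on \<^typ>\<open>nat\<close> whose value at \<open>0\<close> is never used. The alphabet is given by
  its enumeration \<open>\<alpha>\<close>, which need not be injective and whose value at \<open>0\<close> is never used, as is
  the value of \<open>k\<close> at \<open>0\<close>. Words are finite partial functions, with or without the variable
  \<open>\<upsilon>\<close>, which is an element of the type of letters lying outside the alphabet.
\<close>

type_synonym 'a word = "int \<rightharpoonup> 'a"

definition alphabet :: "(int \<Rightarrow> 'a) \<Rightarrow> 'a set" where
  "alphabet \<alpha> = {\<alpha> n | n. n \<noteq> 0}"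

definition letters_at :: "(int \<Rightarrow> 'a) \<Rightarrow> (int \<Rightarrow> nat) \<Rightarrow> int \<Rightarrow> 'a set" where
  "letters_at \<alpha> k n = (if n > 0 then \<alpha> ` {1..int (k n)} else \<alpha> ` {- int (k n)..-1})"

definition dom_neg :: "'a word \<Rightarrow> int set" where
  "dom_neg w = {n \<in> dom w. n < 0}"

definition dom_pos :: "'a word \<Rightarrow> int set" where
  "dom_pos w = {n \<in> dom w. n > 0}"

text \<open>The product \<open>w \<star> u\<close> is only ever formed of words with disjoint domains.\<close>

definition star :: "'a word \<Rightarrow> 'a word \<Rightarrow> 'a word"  (infixr "\<star>" 65) where
  "w \<star> u = w ++ u"

definition star_list :: "'a word list \<Rightarrow> 'a word" where
  "star_list ws = foldr (\<star>) ws Map.empty"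

definition words2 :: "(int \<Rightarrow> 'a) \<Rightarrow> (int \<Rightarrow> nat) \<Rightarrow> 'a word set" where
  "words2 \<alpha> k = {w. finite (dom w) \<and> dom w \<noteq> {} \<and> 0 \<notin> dom w \<and>
     (\<forall>n\<in>dom w. the (w n) \<in> letters_at \<alpha> k n)}"

definition var_words :: "(int \<Rightarrow> 'a) \<Rightarrow> (int \<Rightarrow> nat) \<Rightarrow> 'a \<Rightarrow> 'a word set" where
  "var_words \<alpha> k \<upsilon> = {w. finite (dom w) \<and> dom w \<noteq> {} \<and> 0 \<notin> dom w \<and>
     (\<forall>n\<in>dom w. the (w n) \<in> insert \<upsilon> (letters_at \<alpha> k n)) \<and>
     (\<exists>n\<in>dom w. w n = Some \<upsilon>)}"


subsection \<open>Two-sided words\<close>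

definition var_words2 :: "(int \<Rightarrow> 'a) \<Rightarrow> (int \<Rightarrow> nat) \<Rightarrow> 'a \<Rightarrow> 'a word set" where
  "var_words2 \<alpha> k \<upsilon> = {w \<in> var_words \<alpha> k \<upsilon>.
     (\<exists>n\<in>dom_neg w. w n = Some \<upsilon>) \<and> (\<exists>n\<in>dom_pos w. w n = Some \<upsilon>)}"

definition less_R1 :: "'a word \<Rightarrow> 'a word \<Rightarrow> bool" where
  "less_R1 w u \<longleftrightarrow> (\<exists>A\<^sub>1 A\<^sub>2. dom u = A\<^sub>1 \<union> A\<^sub>2 \<and> A\<^sub>1 \<noteq> {} \<and> A\<^sub>2 \<noteq> {} \<and>
     Max A\<^sub>1 < Min (dom w) \<and> Min (dom w) \<le> Max (dom w) \<and> Max (dom w) < Min A\<^sub>2)"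

definition seqs2 :: "(int \<Rightarrow> 'a) \<Rightarrow> (int \<Rightarrow> nat) \<Rightarrow> 'a \<Rightarrow> (nat \<Rightarrow> 'a word) set" where
  "seqs2 \<alpha> k \<upsilon> = {w. \<forall>n\<ge>1. w n \<in> var_words2 \<alpha> k \<upsilon> \<and> less_R1 (w n) (w (Suc n))}"

text \<open>
  Substitution: \<open>Some (p, q)\<close> stands for the pair \<open>(p, q)\<close> and \<open>None\<close> for \<open>(\<upsilon>, \<upsilon>)\<close>. The function
  is total; the bounds on \<open>p\<close> and \<open>q\<close> are imposed where it is used.
\<close>

definition subst2 :: "(int \<Rightarrow> 'a) \<Rightarrow> 'a \<Rightarrow> 'a word \<Rightarrow> (nat \<times> nat) option \<Rightarrow> 'a word" where
  "subst2 \<alpha> \<upsilon> w c = (case c of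
       None \<Rightarrow> w
     | Some (p, q) \<Rightarrow>
         (\<lambda>n. if w n = Some \<upsilon> then Some (if n > 0 then \<alpha> (int p) else \<alpha> (- int q)) else w n))"

definition choices2 :: "(int \<Rightarrow> nat) \<Rightarrow> nat \<Rightarrow> (nat \<times> nat) option set" where
  "choices2 k n = Some ` ({1..k (int n)} \<times> {1..k (- int n)})"

text \<open>In the next two definitions \<open>xs\<close> lists the indices \<open>n\<^sub>1 < \<dots> < n\<^sub>\<lambda>\<close> with their substitutions.\<close>

definition E2 :: "(int \<Rightarrow> 'a) \<Rightarrow> (int \<Rightarrow> nat) \<Rightarrow> 'a \<Rightarrow> (nat \<Rightarrow> 'a word) \<Rightarrow> 'a word set" where
  "E2 \<alpha> k \<upsilon> w = {star_list (map (\<lambda>(n, c). subst2 \<alpha> \<upsilon> (w n) c) xs) | xs.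
     xs \<noteq> [] \<and> sorted_wrt (<) (map fst xs) \<and>
     (\<forall>(n, c)\<in>set xs. n \<ge> 1 \<and> c \<in> choices2 k n)}"

definition EV2 :: "(int \<Rightarrow> 'a) \<Rightarrow> (int \<Rightarrow> nat) \<Rightarrow> 'a \<Rightarrow> (nat \<Rightarrow> 'a word) \<Rightarrow> 'a word set" where
  "EV2 \<alpha> k \<upsilon> w = {star_list (map (\<lambda>(n, c). subst2 \<alpha> \<upsilon> (w n) c) xs) | xs.
     xs \<noteq> [] \<and> sorted_wrt (<) (map fst xs) \<and>
     (\<forall>(n, c)\<in>set xs. n \<ge> 1 \<and> c \<in> choices2 k n \<union> {None}) \<and>
     (\<exists>(n, c)\<in>set xs. c = None)}"

definition extraction2 ::
  "(int \<Rightarrow> 'a) \<Rightarrow> (int \<Rightarrow> nat) \<Rightarrow> 'a \<Rightarrow> (nat \<Rightarrow> 'a word) \<Rightarrow> (nat \<Rightarrow> 'a word) \<Rightarrow> bool" where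
  "extraction2 \<alpha> k \<upsilon> u w \<longleftrightarrow> u \<in> seqs2 \<alpha> k \<upsilon> \<and> (\<forall>n\<ge>1. u n \<in> EV2 \<alpha> k \<upsilon> w)"


subsection \<open>One-sided words\<close>

definition words1 :: "(int \<Rightarrow> 'a) \<Rightarrow> (int \<Rightarrow> nat) \<Rightarrow> 'a word set" where
  "words1 \<alpha> k = {w \<in> words2 \<alpha> k. dom w \<subseteq> {1..}}"

definition var_words1 :: "(int \<Rightarrow> 'a) \<Rightarrow> (int \<Rightarrow> nat) \<Rightarrow> 'a \<Rightarrow> 'a word set" where
  "var_words1 \<alpha> k \<upsilon> = {w \<in> var_words \<alpha> k \<upsilon>. dom w \<subseteq> {1..}}"

definition less_R2 :: "'a word \<Rightarrow> 'a word \<Rightarrow> bool" where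
  "less_R2 w u \<longleftrightarrow> Max (dom w) < Min (dom u)"

definition seqs1 :: "(int \<Rightarrow> 'a) \<Rightarrow> (int \<Rightarrow> nat) \<Rightarrow> 'a \<Rightarrow> (nat \<Rightarrow> 'a word) set" where
  "seqs1 \<alpha> k \<upsilon> = {w. \<forall>n\<ge>1. w n \<in> var_words1 \<alpha> k \<upsilon> \<and> less_R2 (w n) (w (Suc n))}"

text \<open>Here \<open>Some p\<close> stands for \<open>p\<close> and \<open>None\<close> for \<open>\<upsilon>\<close>.\<close>

definition subst1 :: "(int \<Rightarrow> 'a) \<Rightarrow> 'a \<Rightarrow> 'a word \<Rightarrow> nat option \<Rightarrow> 'a word" where
  "subst1 \<alpha> \<upsilon> w c = (case c of
       None \<Rightarrow> w
     | Some p \<Rightarrow> (\<lambda>n. if w n = Some \<upsilon> then Some (\<alpha> (int p)) else w n))"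

definition choices1 :: "(int \<Rightarrow> nat) \<Rightarrow> nat \<Rightarrow> nat option set" where
  "choices1 k n = Some ` {1..k (int n)}"

definition E1 :: "(int \<Rightarrow> 'a) \<Rightarrow> (int \<Rightarrow> nat) \<Rightarrow> 'a \<Rightarrow> (nat \<Rightarrow> 'a word) \<Rightarrow> 'a word set" where
  "E1 \<alpha> k \<upsilon> w = {star_list (map (\<lambda>(n, c). subst1 \<alpha> \<upsilon> (w n) c) xs) | xs.
     xs \<noteq> [] \<and> sorted_wrt (<) (map fst xs) \<and>
     (\<forall>(n, c)\<in>set xs. n \<ge> 1 \<and> c \<in> choices1 k n)}"

definition EV1 :: "(int \<Rightarrow> 'a) \<Rightarrow> (int \<Rightarrow> nat) \<Rightarrow> 'a \<Rightarrow> (nat \<Rightarrow> 'a word) \<Rightarrow> 'a word set" where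
  "EV1 \<alpha> k \<upsilon> w = {star_list (map (\<lambda>(n, c). subst1 \<alpha> \<upsilon> (w n) c) xs) | xs.
     xs \<noteq> [] \<and> sorted_wrt (<) (map fst xs) \<and>
     (\<forall>(n, c)\<in>set xs. n \<ge> 1 \<and> c \<in> choices1 k n \<union> {None}) \<and>
     (\<exists>(n, c)\<in>set xs. c = None)}"

definition extraction1 ::
  "(int \<Rightarrow> 'a) \<Rightarrow> (int \<Rightarrow> nat) \<Rightarrow> 'a \<Rightarrow> (nat \<Rightarrow> 'a word) \<Rightarrow> (nat \<Rightarrow> 'a word) \<Rightarrow> bool" where
  "extraction1 \<alpha> k \<upsilon> u w \<longleftrightarrow> u \<in> seqs1 \<alpha> k \<upsilon> \<and> (\<forall>n\<ge>1. u n \<in> EV1 \<alpha> k \<upsilon> w)"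


subsection \<open>Convergence\<close>

definition nbhd :: "'x topology \<Rightarrow> 'x \<Rightarrow> 'x set \<Rightarrow> bool" where
  "nbhd T x V \<longleftrightarrow> V \<subseteq> topspace T \<and> (\<exists>U. openin T U \<and> x \<in> U \<and> U \<subseteq> V)"

text \<open>
  Both notions below speak about the family \<open>x\<close> restricted to a set \<open>W\<close> of words. As in
  \<^const>\<open>limitin\<close>, the limit is required to be a point of the space.
\<close>

definition R1_lim :: "'x topology \<Rightarrow> 'a word set \<Rightarrow> ('a word \<Rightarrow> 'x) \<Rightarrow> 'x \<Rightarrow> bool" where
  "R1_lim T W x x0 \<longleftrightarrow> x0 \<in> topspace T \<and>
     (\<forall>V. nbhd T x0 V \<longrightarrow>
       (\<exists>n0::nat. n0 \<ge> 1 \<and>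
         (\<forall>w\<in>W. min (- Max (dom_neg w)) (Min (dom_pos w)) \<ge> int n0 \<longrightarrow> x w \<in> V)))"

definition R2_lim :: "'x topology \<Rightarrow> 'a word set \<Rightarrow> ('a word \<Rightarrow> 'x) \<Rightarrow> 'x \<Rightarrow> bool" where
  "R2_lim T W x x0 \<longleftrightarrow> x0 \<in> topspace T \<and>
     (\<forall>V. nbhd T x0 V \<longrightarrow>
       (\<exists>n0::nat. n0 \<ge> 1 \<and> (\<forall>w\<in>W. Min (dom w) \<ge> int n0 \<longrightarrow> x w \<in> V)))"

end

theory Submission
  imports Defs
begin

text \<open>
  Coding an extraction of \<open>w\<close> by the indices and substitutions it uses turns both parts into one
  statement about located words over \<^typ>\<open>nat\<close> with an increasing sequence of finite alphabets,
  multiplied by overriding. In the compact right topological semigroup of ultrafilters on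
  these words there are an idempotent \<open>p\<close> concentrated on constant words and an ultrafilter
  \<open>q\<close> concentrated on variable words all of whose substitution images equal \<open>p\<close>. The limit
  \<open>x0\<close> is the limit of the family along \<open>p\<close>, and the variable words \<open>u\<^sub>n\<close> are chosen
  recursively from \<open>q\<close>-large sets, as in the Galvin-Glazer proof of Hindman's theorem.
\<close>

subsection \<open>Compact right topological semigroups\<close>

text \<open>The alphabet may grow without bound, so q has to be compatible with all substitutions at
  once. A letter of \<open>A k\<close> is admissible at every position from \<open>k\<close> on, and
  the ultrafilters concentrate beyond every position; hence each substitution acts on them as a
  homomorphism fixing those of constant words. Minimality of p then forces every image of q to be p,
  whatever the number of letters. Finiteness of \<open>A n\<close> matters only in the recursion,
  where finitely many large sets are intersected at each stage. Concentration far out also makes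
  overriding harmless: it is total and associative, and for a fixed left factor it is a union of
  disjoint words for almost all right factors, which is all that the ultrafilter product sees.
  Sidedness disappears in the coding, because the negative and positive parts of \<open>w n\<close>
  share the index \<open>n\<close>.\<close>

lemma Hausdorff_compact_imp_closed:
  fixes S :: "'s::topological_space set"
  assumes "Hausdorff_space (euclidean :: 's topology)" "compact S"
  shows "closed S"
  using compactin_imp_closedin[OF assms(1)] assms(2) by simp

lemma compact_UNIV_fun:
  assumes "compact (UNIV :: 'b::topological_space set)"
  shows "compact (UNIV :: ('a \<Rightarrow> 'b) set)"
proof -
  have "compact_space (product_topology (\<lambda>_::'a. euclidean :: 'b topology) UNIV)"
    using assms unfolding compact_space_product_topology by (simp add: compact_space_def)
  then show ?thesis
    by (simp add: euclidean_product_topology compact_space_def)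
qed

text \<open>Zorn's lemma is applied to complements, turning minimal sets into maximal ones. A chain
  has a bound because its intersection is nonempty by compactness and inherits \<open>P\<close> from
  the closure under intersections.\<close>

lemma minimal_compact_set:
  fixes C :: "'s::topological_space set"
  assumes hausdorff: "Hausdorff_space (euclidean :: 's topology)" and "compact C" "C \<noteq> {}" "P C"
    and P_Inter: "\<And>\<M>. \<M> \<noteq> {} \<Longrightarrow> (\<And>M. M \<in> \<M> \<Longrightarrow> P M) \<Longrightarrow> P (\<Inter>\<M>)"
  obtains M where "M \<subseteq> C" "compact M" "M \<noteq> {}" "P M"
    "\<And>N. N \<subseteq> M \<Longrightarrow> compact N \<Longrightarrow> N \<noteq> {} \<Longrightarrow> P N \<Longrightarrow> N = M"
proof -
  define Q where "Q M \<longleftrightarrow> M \<subseteq> C \<and> compact M \<and> M \<noteq> {} \<and> P M" for M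
  define \<A> where "\<A> = {U. Q (- U)}"
  have "\<exists>M\<in>\<A>. \<forall>X\<in>\<A>. M \<subseteq> X \<longrightarrow> X = M"
  proof (rule subset_Zorn_nonempty)
    have "- C \<in> \<A>"
      using assms by (simp add: \<A>_def Q_def)
    then show "\<A> \<noteq> {}"
      by blast
  next
    fix \<C> assume \<C>: "\<C> \<noteq> {}" "subset.chain \<A> \<C>"
    have Q: "Q (- U)" if "U \<in> \<C>" for U
      using that \<C> by (auto simp: subset_chain_def \<A>_def)
    obtain U where U: "U \<in> \<C>"
      using \<C> by blast
    have eq: "- \<Union>\<C> = \<Inter>(uminus ` \<C>)"
      by auto
    have "- U \<inter> \<Inter>(uminus ` \<C>) \<noteq> {}"
    proof (rule compact_imp_fip)
      show "compact (- U)"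
        using Q[OF U] by (simp add: Q_def)
      show "closed T" if "T \<in> uminus ` \<C>" for T
        using that Q by (auto simp: Q_def intro: Hausdorff_compact_imp_closed[OF hausdorff])
      fix \<F> assume \<F>: "finite \<F>" "\<F> \<subseteq> uminus ` \<C>"
      then obtain \<D> where \<D>: "\<D> \<subseteq> \<C>" "finite \<D>" "\<F> = uminus ` \<D>"
        by (meson finite_subset_image)
      have "insert U \<D> \<subseteq> \<C>"
        using \<D>(1) U by simp
      then have "subset.chain \<A> (insert U \<D>)"
        using \<C>(2) unfolding subset_chain_def by (meson subset_trans subsetD)
      \<comment> \<open>A finite chain has a largest member, so this finite intersection contains
        one of the given nonempty sets.\<close>
      then have "\<Union>(insert U \<D>) \<in> insert U \<D>"
        using \<D>(2) by (intro Union_in_chain) auto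
      then have "Q (- \<Union>(insert U \<D>))"
        using Q \<open>insert U \<D> \<subseteq> \<C>\<close> by (meson subsetD)
      moreover have "- \<Union>(insert U \<D>) \<subseteq> - U \<inter> \<Inter>\<F>"
        unfolding \<D>(3) by (intro subsetI) simp
      ultimately show "- U \<inter> \<Inter>\<F> \<noteq> {}"
        unfolding Q_def by (metis subset_empty)
    qed
    moreover have "compact (- U)" "\<forall>V\<in>\<C>. closed (- V)"
      using Q U Hausdorff_compact_imp_closed[OF hausdorff] by (auto simp: Q_def)
    then have "compact (- U \<inter> \<Inter>(uminus ` \<C>))"
      by (intro compact_Int_closed closed_INT)
    moreover have "- U \<inter> \<Inter>(uminus ` \<C>) = \<Inter>(uminus ` \<C>)"
      using U by blast
    moreover have "P (\<Inter>(uminus ` \<C>))"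
      using Q \<C> by (intro P_Inter) (auto simp: Q_def)
    moreover have "- \<Union>\<C> \<subseteq> C"
      using Q[OF U] U unfolding Q_def by blast
    ultimately show "\<Union>\<C> \<in> \<A>"
      by (simp add: \<A>_def Q_def eq)
  qed
  then obtain W where W: "Q (- W)" "\<And>X. Q (- X) \<Longrightarrow> W \<subseteq> X \<Longrightarrow> X = W"
    by (auto simp: \<A>_def)
  show thesis
  proof (rule that[of "- W"])
    fix N assume N: "N \<subseteq> - W" "compact N" "N \<noteq> {}" "P N"
    then have "Q (- (- N))"
      using W(1) by (auto simp: Q_def)
    then show "N = - W"
      using W(2)[of "- N"] N(1) by blast
  qed (use W(1) in \<open>auto simp: Q_def\<close>)
qed

section \<open>Idempotents and minimal left ideals\<close>

locale right_topological_semigroup =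
  fixes mult :: "'s::topological_space \<Rightarrow> 's \<Rightarrow> 's"  (infixl "\<odot>" 70)
  assumes hausdorff: "Hausdorff_space (euclidean :: 's topology)"
    and assoc: "(x \<odot> y) \<odot> z = x \<odot> (y \<odot> z)"
    and continuous_mult_left: "continuous_on UNIV (\<lambda>x. x \<odot> y)"
begin

lemma compact_right_translate: "compact C \<Longrightarrow> compact ((\<lambda>x. x \<odot> y) ` C)"
  by (intro compact_continuous_image continuous_on_subset[OF continuous_mult_left]) auto

text \<open>In a minimal compact subsemigroup \<open>M\<close>, both \<open>M e\<close> and the set
  of \<open>x\<close> in \<open>M\<close> with \<open>x e = e\<close> are compact subsemigroups, so
  each is all of \<open>M\<close>. The equality for the first makes the second nonempty.\<close>

theorem Ellis_idempotent:
  assumes "compact C" "C \<noteq> {}" "\<And>x y. x \<in> C \<Longrightarrow> y \<in> C \<Longrightarrow> x \<odot> y \<in> C"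
  obtains e where "e \<in> C" "e \<odot> e = e"
proof -
  define P where "P M \<longleftrightarrow> (\<forall>x\<in>M. \<forall>y\<in>M. x \<odot> y \<in> M)" for M
  obtain M where M: "M \<subseteq> C" "compact M" "M \<noteq> {}" "P M"
    and min: "\<And>N. N \<subseteq> M \<Longrightarrow> compact N \<Longrightarrow> N \<noteq> {} \<Longrightarrow> P N \<Longrightarrow> N = M"
    using minimal_compact_set[OF hausdorff, of C P] assms by (auto simp: P_def)
  obtain e where e: "e \<in> M"
    using M by blast
  have "(\<lambda>x. x \<odot> e) ` M = M"
  proof (rule min)
    show "P ((\<lambda>x. x \<odot> e) ` M)"
      unfolding P_def
    proof clarify
      fix x y assume "x \<in> M" "y \<in> M"
      then have "x \<odot> e \<odot> y \<in> M"
        using M(4) e by (auto simp: P_def)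
      then show "x \<odot> e \<odot> (y \<odot> e) \<in> (\<lambda>x. x \<odot> e) ` M"
        by (metis assoc imageI)
    qed
    show "(\<lambda>x. x \<odot> e) ` M \<subseteq> M"
      using M(4) e unfolding P_def by blast
    show "compact ((\<lambda>x. x \<odot> e) ` M)"
      by (rule compact_right_translate[OF M(2)])
  qed (use M(3) in simp)
  with e have "e \<in> (\<lambda>x. x \<odot> e) ` M"
    by simp
  then obtain f where f: "f \<in> M" "f \<odot> e = e"
    by (metis imageE)
  have "M \<inter> (\<lambda>x. x \<odot> e) -` {e} = M"
  proof (rule min)
    show "compact (M \<inter> (\<lambda>x. x \<odot> e) -` {e})"
      using M(2) continuous_mult_left
      by (intro compact_Int_closed closed_vimage Hausdorff_compact_imp_closed[OF hausdorff]) auto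
    show "P (M \<inter> (\<lambda>x. x \<odot> e) -` {e})"
      using M(4) by (auto simp: P_def assoc)
  qed (use f in auto)
  then have "e \<odot> e = e"
    using e by blast
  then show thesis
    using that e M(1) by blast
qed

text \<open>Every \<open>L y\<close> with \<open>y\<close> in a minimal compact left ideal
  \<open>M\<close> is again a compact left ideal inside \<open>M\<close>, so each element generates
  all of \<open>M\<close>.\<close>

lemma minimal_left_ideal:
  assumes "compact L" "L \<noteq> {}" "\<And>x y. x \<in> L \<Longrightarrow> y \<in> L \<Longrightarrow> x \<odot> y \<in> L"
  obtains M where "M \<subseteq> L" "compact M" "M \<noteq> {}" "\<And>y. y \<in> M \<Longrightarrow> (\<lambda>x. x \<odot> y) ` L = M"
proof -
  define P where "P M \<longleftrightarrow> (\<forall>x\<in>L. \<forall>y\<in>M. x \<odot> y \<in> M)" for M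
  obtain M where M: "M \<subseteq> L" "compact M" "M \<noteq> {}" "P M"
    and min: "\<And>N. N \<subseteq> M \<Longrightarrow> compact N \<Longrightarrow> N \<noteq> {} \<Longrightarrow> P N \<Longrightarrow> N = M"
    using minimal_compact_set[OF hausdorff, of L P] assms by (auto simp: P_def)
  have "(\<lambda>x. x \<odot> y) ` L = M" if "y \<in> M" for y
  proof (rule min)
    show "P ((\<lambda>x. x \<odot> y) ` L)"
      unfolding P_def
    proof clarify
      fix x z assume "x \<in> L" "z \<in> L"
      then have "x \<odot> z \<in> L"
        by (rule assms(3))
      then show "x \<odot> (z \<odot> y) \<in> (\<lambda>x. x \<odot> y) ` L"
        by (metis assoc imageI)
    qed
    show "(\<lambda>x. x \<odot> y) ` L \<subseteq> M"
      using M(4) that unfolding P_def by blast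
    show "compact ((\<lambda>x. x \<odot> y) ` L)"
      by (rule compact_right_translate[OF assms(1)])
  qed (use assms(2) in simp)
  then show thesis
    by (rule that[OF M(1-3)])
qed

text \<open>
  The idempotent \<open>p\<close> lies in a minimal left ideal of \<open>L\<close>, hence is minimal among idempotents of
  \<open>L\<close>; \<open>q\<close> is an idempotent of \<open>V\<close> below \<open>p\<close>, so its retractions are idempotents of \<open>L\<close> below \<open>p\<close>.
\<close>

theorem retractions_to_minimal_idempotent:
  assumes L: "compact L" "L \<noteq> {}" "\<And>x y. x \<in> L \<Longrightarrow> y \<in> L \<Longrightarrow> x \<odot> y \<in> L"
    and V: "compact V" "V \<noteq> {}" "\<And>x y. x \<in> V \<Longrightarrow> y \<in> V \<Longrightarrow> x \<odot> y \<in> V"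
    and LV: "\<And>x y. x \<in> L \<Longrightarrow> y \<in> V \<Longrightarrow> x \<odot> y \<in> V"
    and VL: "\<And>x y. x \<in> V \<Longrightarrow> y \<in> L \<Longrightarrow> x \<odot> y \<in> V"
    and hom: "\<And>a x y. a \<in> I \<Longrightarrow> T a (x \<odot> y) = T a x \<odot> T a y"
    and T_V: "\<And>a x. a \<in> I \<Longrightarrow> x \<in> V \<Longrightarrow> T a x \<in> L"
    and T_L: "\<And>a x. a \<in> I \<Longrightarrow> x \<in> L \<Longrightarrow> T a x = x"
  obtains p q where "p \<in> L" "p \<odot> p = p" "q \<in> V" "\<And>a. a \<in> I \<Longrightarrow> T a q = p"
proof -
  obtain M where M: "M \<subseteq> L" "compact M" "M \<noteq> {}"
    and gen: "\<And>y. y \<in> M \<Longrightarrow> (\<lambda>x. x \<odot> y) ` L = M"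
    using minimal_left_ideal[OF L] by metis
  have LM: "x \<odot> y \<in> M" if "x \<in> L" "y \<in> M" for x y
    using gen[OF that(2)] that(1) by blast
  obtain p where p: "p \<in> M" "p \<odot> p = p"
    using Ellis_idempotent[of M] M LM by (metis subsetD)
  then have pL: "p \<in> L"
    using M by blast
  \<comment> \<open>Every element of \<open>V p\<close> is fixed by right multiplication with
    \<open>p\<close>. An idempotent \<open>e\<close> found there therefore yields the idempotent
    \<open>p e\<close>, fixed by \<open>p\<close> from both sides and still in
    \<open>V\<close>.\<close>
  obtain e where e: "e \<in> (\<lambda>v. v \<odot> p) ` V" "e \<odot> e = e"
  proof (rule Ellis_idempotent)
    show "compact ((\<lambda>v. v \<odot> p) ` V)"
      by (intro compact_right_translate V)
    fix x y assume "x \<in> (\<lambda>v. v \<odot> p) ` V" "y \<in> (\<lambda>v. v \<odot> p) ` V"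
    then obtain v v' where v: "v \<in> V" "v' \<in> V" "x = v \<odot> p" "y = v' \<odot> p"
      by blast
    then have "v \<odot> p \<odot> v' \<in> V"
      using pL VL V(3) by blast
    then show "x \<odot> y \<in> (\<lambda>v. v \<odot> p) ` V"
      using v by (metis assoc imageI)
  qed (use V(2) in auto)
  then obtain v where v: "v \<in> V" "e = v \<odot> p"
    by blast
  have ep: "e \<odot> p = e"
    using v p by (simp add: assoc)
  have "p \<odot> e \<in> V"
    using v pL VL LV by blast
  moreover have "T a (p \<odot> e) = p" if a: "a \<in> I" for a
  proof -
    define r where "r = T a (p \<odot> e)"
    have r: "r = p \<odot> (T a v \<odot> p)"
      using a v T_L[OF a pL] by (simp add: r_def hom)
    have "r \<in> M"
      unfolding r using LM T_V[OF a v(1)] p(1) pL by blast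
    have "(p \<odot> e) \<odot> (p \<odot> e) = p \<odot> e"
      by (metis assoc e(2) ep)
    then have "r \<odot> r = r"
      using hom[OF a] by (metis r_def)
    \<comment> \<open>Minimality enters here: \<open>r\<close> generates \<open>M\<close>, so
      \<open>p\<close> is a left multiple of \<open>r\<close>, and the idempotent \<open>r\<close>
      fixes such multiples from the right.\<close>
    moreover have "p \<in> (\<lambda>x. x \<odot> r) ` L"
      using gen[OF \<open>r \<in> M\<close>] p(1) by simp
    then obtain s where "p = s \<odot> r"
      by blast
    ultimately have "p \<odot> r = p"
      by (simp add: assoc)
    moreover have "p \<odot> r = r"
      unfolding r by (simp add: assoc[symmetric] p)
    ultimately show ?thesis
      by (simp add: r_def)
  qed
  ultimately show thesis
    by (rule that[OF pL p(2)])
qed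

end


subsection \<open>Ultrafilters as Boolean homomorphisms\<close>

text \<open>Recording the truth value on each predicate makes an ultrafilter a point of a power of
  \<open>bool\<close>. Compactness then comes from Tychonoff's theorem, and the topology is the
  coordinatewise one.\<close>

definition ultrafilter :: "(('a \<Rightarrow> bool) \<Rightarrow> bool) \<Rightarrow> bool" where
  "ultrafilter p \<longleftrightarrow> (\<forall>P Q. p (\<lambda>x. P x \<and> Q x) \<longleftrightarrow> p P \<and> p Q) \<and> (\<forall>P. p (\<lambda>x. \<not> P x) \<longleftrightarrow> \<not> p P)"

lemma ultrafilter_conj: "ultrafilter p \<Longrightarrow> p (\<lambda>x. P x \<and> Q x) \<longleftrightarrow> p P \<and> p Q"
  by (simp add: ultrafilter_def)

lemma ultrafilter_not: "ultrafilter p \<Longrightarrow> p (\<lambda>x. \<not> P x) \<longleftrightarrow> \<not> p P"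
  by (simp add: ultrafilter_def)

lemma ultrafilter_mono:
  assumes "ultrafilter p" "p P" "\<And>x. P x \<Longrightarrow> Q x"
  shows "p Q"
proof -
  have "(\<lambda>x. P x \<and> Q x) = P"
    using assms(3) by blast
  then show ?thesis
    using ultrafilter_conj[OF assms(1), of P Q] assms(2) by simp
qed

lemma ultrafilter_True:
  assumes "ultrafilter p"
  shows "p (\<lambda>x. True)"
proof (rule ccontr)
  assume *: "\<not> p (\<lambda>x. True)"
  then have "p (\<lambda>x. False)"
    using ultrafilter_not[OF assms, of "\<lambda>x. True"] by simp
  then show False
    using ultrafilter_mono[OF assms, of "\<lambda>x. False" "\<lambda>x. True"] * by simp
qed

lemma ultrafilter_ex:
  assumes "ultrafilter p" "p P"
  shows "\<exists>x. P x"
proof (rule ccontr)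
  assume "\<nexists>x. P x"
  then have "p (\<lambda>x. \<not> True)"
    using ultrafilter_mono[OF assms] by blast
  then show False
    unfolding ultrafilter_not[OF assms(1)] using ultrafilter_True[OF assms(1)] by simp
qed

lemma ultrafilter_cong:
  assumes "ultrafilter p" "p R" "\<And>x. R x \<Longrightarrow> P x \<longleftrightarrow> Q x"
  shows "p P \<longleftrightarrow> p Q"
proof -
  have "(\<lambda>x. R x \<and> P x) = (\<lambda>x. R x \<and> Q x)"
    using assms(3) by blast
  then show ?thesis
    using ultrafilter_conj[OF assms(1), of R P] ultrafilter_conj[OF assms(1), of R Q] assms(2) by simp
qed

lemma ultrafilter_Ball:
  assumes "ultrafilter p" "finite F" "\<And>y. y \<in> F \<Longrightarrow> p (Q y)"
  shows "p (\<lambda>x. \<forall>y\<in>F. Q y x)"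
  using assms(2,3)
  by (induction F) (auto simp: ultrafilter_True[OF assms(1)] ultrafilter_conj[OF assms(1)])

lemma ultrafilter_Bex:
  assumes "ultrafilter p" "finite F" "p (\<lambda>x. \<exists>y\<in>F. Q y x)"
  shows "\<exists>y\<in>F. p (Q y)"
proof (rule ccontr)
  assume "\<not> ?thesis"
  then have "p (\<lambda>x. \<not> Q y x)" if "y \<in> F" for y
    using that ultrafilter_not[OF assms(1), of "Q y"] by simp
  then have "p (\<lambda>x. \<forall>y\<in>F. \<not> Q y x)"
    by (rule ultrafilter_Ball[OF assms(1), OF assms(2)])
  then show False
    using assms(3) ultrafilter_not[OF assms(1), of "\<lambda>x. \<exists>y\<in>F. Q y x"] by simp
qed

lemma closed_Collect_fun_apply: "closed {p :: ('a \<Rightarrow> bool). p P}"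
proof -
  have "closed ((\<lambda>p. p P) -` {True} :: ('a \<Rightarrow> bool) set)"
    by (intro closed_vimage continuous_on_product_coordinates) auto
  then show ?thesis
    by (simp add: vimage_def)
qed

lemma open_Collect_fun_apply: "open {p :: ('a \<Rightarrow> bool). p P}"
proof -
  have "open ((\<lambda>p. p P) -` {True} :: ('a \<Rightarrow> bool) set)"
    by (intro open_vimage continuous_on_product_coordinates open_discrete)
  then show ?thesis
    by (simp add: vimage_def)
qed

text \<open>Each defining condition involves finitely many coordinates with values in the discrete
  space \<open>bool\<close>, so it is closed.\<close>

lemma compact_ultrafilter: "compact {p. ultrafilter p \<and> (\<forall>i. p (P i))}"
proof -
  have "closed {p :: ('a \<Rightarrow> bool) \<Rightarrow> bool. p (\<lambda>x. P x \<and> Q x) \<longleftrightarrow> p P \<and> p Q}" for P Q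
    unfolding iff_conv_conj_imp
    by (intro closed_Collect_conj closed_Collect_imp open_Collect_conj
        closed_Collect_fun_apply open_Collect_fun_apply)
  moreover have "closed {p :: ('a \<Rightarrow> bool) \<Rightarrow> bool. p (\<lambda>x. \<not> P x) \<longleftrightarrow> \<not> p P}" for P
    unfolding iff_conv_conj_imp
    by (intro closed_Collect_conj closed_Collect_imp closed_Collect_neg open_Collect_neg
        closed_Collect_fun_apply open_Collect_fun_apply)
  ultimately have "closed {p. ultrafilter p \<and> (\<forall>i. p (P i))}"
    unfolding ultrafilter_def
    by (intro closed_Collect_conj closed_Collect_all closed_Collect_fun_apply)
  moreover have "compact (UNIV :: (('a \<Rightarrow> bool) \<Rightarrow> bool) set)"
    by (intro compact_UNIV_fun finite_imp_compact) simp
  ultimately show ?thesis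
    using compact_Int_closed by fastforce
qed

lemma ultrafilter_principal: "ultrafilter (\<lambda>P. P x)"
  by (simp add: ultrafilter_def)

text \<open>The constraints are nested, so a witness for the last of finitely many satisfies them
  all, and its principal ultrafilter shows the finite intersection property.\<close>

lemma ultrafilter_exists:
  fixes P :: "nat \<Rightarrow> 'a \<Rightarrow> bool"
  assumes "\<And>n. \<exists>x. P n x" "\<And>m n x. m \<le> n \<Longrightarrow> P n x \<Longrightarrow> P m x"
  shows "\<exists>p. ultrafilter p \<and> (\<forall>n. p (P n))"
proof -
  have "{p :: ('a \<Rightarrow> bool) \<Rightarrow> bool. ultrafilter p} \<inter> (\<Inter>n\<in>UNIV. {p. p (P n)}) \<noteq> {}"
  proof (rule compact_imp_fip_image)
    show "compact {p :: ('a \<Rightarrow> bool) \<Rightarrow> bool. ultrafilter p}"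
      using compact_ultrafilter[of "\<lambda>_ _. True"] by (metis (no_types, lifting) Collect_cong ultrafilter_True)
    fix I :: "nat set" assume "finite I"
    then obtain m where m: "\<forall>i\<in>I. i \<le> m"
      using finite_nat_set_iff_bounded_le by blast
    obtain x where "P m x"
      using assms(1) by blast
    then have "\<forall>i\<in>I. P i x"
      using m assms(2) by blast
    then have "(\<lambda>P. P x) \<in> {p. ultrafilter p} \<inter> (\<Inter>n\<in>I. {p. p (P n)})"
      using ultrafilter_principal by auto
    then show "{p. ultrafilter p} \<inter> (\<Inter>n\<in>I. {p. p (P n)}) \<noteq> {}"
      by blast
  qed (rule closed_Collect_fun_apply)
  then show ?thesis
    by auto
qed

text \<open>Were there no limit, every point would have an open neighbourhood whose preimage is not
  large. Finitely many of these cover the space, and an ultrafilter makes one member of a finite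
  cover large.\<close>

lemma ultrafilter_limit:
  assumes "compact_space T" "ultrafilter p" "p (\<lambda>w. f w \<in> topspace T)"
  shows "\<exists>x\<in>topspace T. \<forall>U. openin T U \<and> x \<in> U \<longrightarrow> p (\<lambda>w. f w \<in> U)"
proof (rule ccontr)
  assume "\<not> ?thesis"
  then obtain U where U: "\<And>x. x \<in> topspace T \<Longrightarrow> openin T (U x) \<and> x \<in> U x \<and> \<not> p (\<lambda>w. f w \<in> U x)"
    by metis
  have "\<exists>\<F>. finite \<F> \<and> \<F> \<subseteq> U ` topspace T \<and> topspace T \<subseteq> \<Union>\<F>"
    using assms(1)[unfolded compact_space_alt, rule_format, of "U ` topspace T"] U by fastforce
  then obtain F where "F \<subseteq> topspace T" "finite F" "topspace T \<subseteq> \<Union>(U ` F)"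
    by (metis finite_subset_image)
  then have *: "f w \<in> topspace T \<Longrightarrow> \<exists>x\<in>F. f w \<in> U x" for w
    by blast
  have "p (\<lambda>w. \<exists>x\<in>F. f w \<in> U x)"
    by (rule ultrafilter_mono[OF assms(2), OF assms(3) *])
  from ultrafilter_Bex[OF assms(2), OF \<open>finite F\<close> this] show False
    using U \<open>F \<subseteq> topspace T\<close> by fast
qed

section \<open>Products and images of ultrafilters\<close>

definition ultra_mult :: "('a \<Rightarrow> 'a \<Rightarrow> 'a) \<Rightarrow> (('a \<Rightarrow> bool) \<Rightarrow> bool) \<Rightarrow> (('a \<Rightarrow> bool) \<Rightarrow> bool) \<Rightarrow> (('a \<Rightarrow> bool) \<Rightarrow> bool)" where
  "ultra_mult f p q = (\<lambda>P. p (\<lambda>x. q (\<lambda>y. P (f x y))))"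

definition ultra_map :: "('a \<Rightarrow> 'b) \<Rightarrow> (('a \<Rightarrow> bool) \<Rightarrow> bool) \<Rightarrow> (('b \<Rightarrow> bool) \<Rightarrow> bool)" where
  "ultra_map f p = (\<lambda>P. p (\<lambda>x. P (f x)))"

lemma ultrafilter_ultra_mult: "ultrafilter p \<Longrightarrow> ultrafilter q \<Longrightarrow> ultrafilter (ultra_mult f p q)"
  by (simp add: ultrafilter_def ultra_mult_def)

lemma ultrafilter_ultra_map: "ultrafilter p \<Longrightarrow> ultrafilter (ultra_map f p)"
  by (simp add: ultrafilter_def ultra_map_def)

text \<open>Quantifying over \<open>p\<close> outermost makes each value of
  \<open>ultra_mult f p q\<close> a coordinate of \<open>p\<close>, which gives the continuity.
  Associativity follows by unfolding for arbitrary functionals, so the whole function space is the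
  semigroup and ultrafilters enter as compact subsets.\<close>

lemma right_topological_semigroup_ultra_mult:
  assumes "\<And>x y z. f (f x y) z = f x (f y z)"
  shows "right_topological_semigroup (ultra_mult (f :: 'a \<Rightarrow> 'a \<Rightarrow> 'a))"
proof
  have "Hausdorff_space (euclidean :: bool topology)"
    unfolding Hausdorff_space_def disjnt_def open_openin[symmetric]
    using hausdorff[where 'a = bool] by blast
  then have "Hausdorff_space (product_topology (\<lambda>_::'a \<Rightarrow> bool. euclidean :: bool topology) UNIV)"
    unfolding Hausdorff_space_product_topology by simp
  then show "Hausdorff_space (euclidean :: (('a \<Rightarrow> bool) \<Rightarrow> bool) topology)"
    by (simp add: euclidean_product_topology)
  show "continuous_on UNIV (\<lambda>p. ultra_mult f p q)" for q
    unfolding ultra_mult_def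
    by (intro continuous_on_coordinatewise_then_product continuous_on_product_coordinates)
qed (simp add: ultra_mult_def assms)


subsection \<open>Located words over an increasing alphabet\<close>

text \<open>
  Here a located word is a map from \<^typ>\<open>nat\<close>, with \<open>None\<close> in place of the variable; a letter
  occurring at position \<open>n\<close> has to belong to \<open>A n\<close>.
\<close>

type_synonym 'c lword = "nat \<rightharpoonup> 'c option"

definition lword :: "(nat \<Rightarrow> 'c set) \<Rightarrow> nat \<Rightarrow> 'c lword \<Rightarrow> bool" where
  "lword A m w \<longleftrightarrow> finite (dom w) \<and> dom w \<noteq> {} \<and> dom w \<subseteq> {m..} \<and>
     (\<forall>n c. w n = Some (Some c) \<longrightarrow> c \<in> A n)"

definition variable_lword :: "'c lword \<Rightarrow> bool" where
  "variable_lword w \<longleftrightarrow> (\<exists>n. w n = Some None)"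

text \<open>Letters are wrapped again in \<open>Some\<close>, so that instances remain in the type
  of located words and can be multiplied with them.\<close>

definition lsubst :: "'c \<Rightarrow> 'c lword \<Rightarrow> 'c lword" where
  "lsubst c w = (\<lambda>n. map_option (\<lambda>a. Some (case a of None \<Rightarrow> c | Some b \<Rightarrow> b)) (w n))"

definition lprod :: "(nat \<Rightarrow> 'c lword) \<Rightarrow> (nat \<times> 'c) list \<Rightarrow> 'c lword" where
  "lprod u xs = foldr (++) (map (\<lambda>(n, c). lsubst c (u n)) xs) Map.empty"

lemma dom_lsubst [simp]: "dom (lsubst c w) = dom w"
  by (auto simp: lsubst_def)

lemma lsubst_map_add: "lsubst c (v ++ w) = lsubst c v ++ lsubst c w"
  by (auto simp: lsubst_def map_add_def split: option.splits)

lemma lsubst_constant: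
  assumes "\<not> variable_lword w"
  shows "lsubst c w = w"
proof
  fix n
  show "lsubst c w n = w n"
  proof (cases "w n")
    case (Some a)
    with assms obtain b where "a = Some b"
      unfolding variable_lword_def by (metis not_None_eq)
    with Some show ?thesis
      by (auto simp: lsubst_def)
  qed (simp add: lsubst_def)
qed

lemma not_variable_lsubst: "\<not> variable_lword (lsubst c w)"
  by (auto simp: lsubst_def variable_lword_def)

lemma lword_antimono: "m \<le> n \<Longrightarrow> lword A n w \<Longrightarrow> lword A m w"
  by (auto simp: lword_def)

lemma lword_map_add: "lword A m v \<Longrightarrow> lword A m w \<Longrightarrow> lword A m (v ++ w)"
  by (auto simp: lword_def map_add_Some_iff)

text \<open>The word starts at \<open>m\<close> or later, where monotonicity still admits the letter
  \<open>c\<close>.\<close>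

lemma lword_lsubst:
  assumes "mono A" "c \<in> A m" "lword A m w"
  shows "lword A m (lsubst c w)"
proof -
  have "c \<in> A n" if "n \<in> dom w" for n
    using assms that monoD[OF assms(1), of m n] by (auto simp: lword_def)
  then show ?thesis
    using assms(3) unfolding lword_def dom_lsubst
    by (auto simp: lsubst_def split: option.splits)
qed

text \<open>Without disjointness, overriding could erase the only variable of
  \<open>v\<close>.\<close>

lemma variable_lword_map_add:
  assumes "dom v \<inter> dom w = {}"
  shows "variable_lword (v ++ w) \<longleftrightarrow> variable_lword v \<or> variable_lword w"
proof -
  have "v n = Some None \<Longrightarrow> w n = None" for n
    using assms by (metis disjoint_iff domI domIff)
  then show ?thesis
    unfolding variable_lword_def map_add_Some_iff by metis
qed

text \<open>The ultrafilters below concentrate on every tail of positions, so for a fixed left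
  factor almost all right factors are disjoint from it.\<close>

lemma lword_disjoint:
  assumes "lword A m v"
  shows "\<exists>M\<ge>m. \<forall>w. lword A M w \<longrightarrow> dom v \<inter> dom w = {}"
proof -
  have "finite (dom v)"
    using assms by (simp add: lword_def)
  then obtain k where k: "\<forall>i\<in>dom v. i < k"
    by (auto simp: finite_nat_set_iff_bounded)
  have "dom v \<inter> dom w = {}" if "lword A (max k m) w" for w
  proof -
    have "dom w \<subseteq> {k..}"
      using that by (auto simp: lword_def)
    then show ?thesis
      using k by (meson atLeast_iff disjoint_iff leD subsetD)
  qed
  then show ?thesis
    by (intro exI[of _ "max k m"]) simp
qed

text \<open>Both semigroups of the argument at once: \<open>b = False\<close> for constant words and
  \<open>b = True\<close> for variable words. Quantifying over every \<open>m\<close> pushes the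
  ultrafilter beyond each position.\<close>

definition lultra :: "(nat \<Rightarrow> 'c set) \<Rightarrow> bool \<Rightarrow> (('c lword \<Rightarrow> bool) \<Rightarrow> bool) set" where
  "lultra A b = {p. ultrafilter p \<and> (\<forall>m. p (\<lambda>w. lword A m w \<and> variable_lword w = b))}"

lemma lultra_ultrafilter: "p \<in> lultra A b \<Longrightarrow> ultrafilter p"
  by (simp add: lultra_def)

lemma lultra_lword: "p \<in> lultra A b \<Longrightarrow> p (\<lambda>w. lword A m w \<and> variable_lword w = b)"
  by (simp add: lultra_def)

lemma compact_lultra: "compact (lultra A b)"
  unfolding lultra_def by (rule compact_ultrafilter)

lemma lultra_nonempty:
  assumes "mono A" "c \<in> A k"
  shows "lultra A b \<noteq> {}"
proof -
  have "\<exists>w. lword A m w \<and> variable_lword w = b" for m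
  proof -
    have "c \<in> A (max m k)"
      using assms monoD[OF assms(1), of k "max m k"] by auto
    then show ?thesis
      by (intro exI[of _ "[max m k \<mapsto> if b then None else Some c]"])
         (auto simp: lword_def variable_lword_def)
  qed
  then have "\<exists>p. ultrafilter p \<and> (\<forall>m. p (\<lambda>w. lword A m w \<and> variable_lword w = b))"
    by (rule ultrafilter_exists) (auto intro: lword_antimono)
  then show ?thesis
    by (simp add: lultra_def)
qed

text \<open>For fixed \<open>v\<close>, \<open>q\<close>-almost every \<open>w\<close> starts beyond
  \<open>v\<close>, so a variable on either side survives. The cases of \<open>b\<close> and
  \<open>b'\<close> give all the closure properties required of the two semigroups.\<close>

lemma ultra_mult_lultra:
  assumes "p \<in> lultra A b" "q \<in> lultra A b'"
  shows "ultra_mult (++) p q \<in> lultra A (b \<or> b')"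
proof -
  have p: "ultrafilter p" and q: "ultrafilter q"
    using assms by (auto dest: lultra_ultrafilter)
  have "p (\<lambda>v. q (\<lambda>w. lword A m (v ++ w) \<and> variable_lword (v ++ w) = (b \<or> b')))" for m
  proof (rule ultrafilter_mono[OF p, OF lultra_lword[OF assms(1), of m]])
    fix v assume v: "lword A m v \<and> variable_lword v = b"
    then obtain M where M: "M \<ge> m" "\<forall>w. lword A M w \<longrightarrow> dom v \<inter> dom w = {}"
      using lword_disjoint by blast
    show "q (\<lambda>w. lword A m (v ++ w) \<and> variable_lword (v ++ w) = (b \<or> b'))"
    proof (rule ultrafilter_mono[OF q, OF lultra_lword[OF assms(2), of M]])
      fix w assume w: "lword A M w \<and> variable_lword w = b'"
      then show "lword A m (v ++ w) \<and> variable_lword (v ++ w) = (b \<or> b')"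
        using v M variable_lword_map_add[of v w] lword_map_add[of A m v w] lword_antimono[of m M A w]
        by auto
    qed
  qed
  then show ?thesis
    by (simp add: lultra_def ultra_mult_def ultrafilter_ultra_mult[OF p q, unfolded ultra_mult_def])
qed

text \<open>A letter of \<open>A k\<close> may be inadmissible before position \<open>k\<close>, but
  the ultrafilter ignores words that begin there.\<close>

lemma ultra_map_lsubst_lultra:
  assumes "mono A" "c \<in> A k" "p \<in> lultra A b"
  shows "ultra_map (lsubst c) p \<in> lultra A False"
proof -
  have p: "ultrafilter p"
    using assms by (auto dest: lultra_ultrafilter)
  have "p (\<lambda>w. lword A m (lsubst c w) \<and> variable_lword (lsubst c w) = False)" for m
  proof (rule ultrafilter_mono[OF p, OF lultra_lword[OF assms(3), of "max m k"]])
    fix w assume "lword A (max m k) w \<and> variable_lword w = b"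
    moreover have "c \<in> A (max m k)"
      using assms monoD[OF assms(1), of k "max m k"] by auto
    ultimately have "lword A (max m k) (lsubst c w)"
      using lword_lsubst[OF assms(1)] by blast
    then show "lword A m (lsubst c w) \<and> variable_lword (lsubst c w) = False"
      using lword_antimono[of m "max m k"] by (simp add: not_variable_lsubst)
  qed
  then show ?thesis
    by (simp add: lultra_def ultra_map_def ultrafilter_ultra_map[OF p, unfolded ultra_map_def])
qed

lemma ultra_map_lsubst_constant:
  assumes "p \<in> lultra A False"
  shows "ultra_map (lsubst c) p = p"
proof
  fix P
  show "ultra_map (lsubst c) p P = p P"
    unfolding ultra_map_def
    using ultrafilter_cong[OF lultra_ultrafilter[OF assms], OF lultra_lword[OF assms, of 0],
        of "\<lambda>w. P (lsubst c w)" P]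
    by (simp add: lsubst_constant)
qed

text \<open>The substitutions are homomorphisms for overriding and fix constant words, so they are
  the required retractions. Indexing them by the union of all \<open>A n\<close> gives a single
  \<open>q\<close> for the whole alphabet.\<close>

lemma lultra_idempotent:
  assumes "mono A" "c0 \<in> A k0"
  obtains p q where "p \<in> lultra A False" "ultra_mult (++) p p = p" "q \<in> lultra A True"
    "\<And>c. c \<in> (\<Union>n. A n) \<Longrightarrow> ultra_map (lsubst c) q = p"
proof -
  interpret right_topological_semigroup "ultra_mult (++) :: (('c lword \<Rightarrow> bool) \<Rightarrow> bool) \<Rightarrow> _"
    by (rule right_topological_semigroup_ultra_mult) simp
  show thesis
  proof (rule retractions_to_minimal_idempotent[of "lultra A False" "lultra A True" "\<Union>n. A n"
        "\<lambda>c. ultra_map (lsubst c)"])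
    show "compact (lultra A False)" "compact (lultra A True)"
      by (rule compact_lultra)+
    show "lultra A False \<noteq> {}" "lultra A True \<noteq> {}"
      by (rule lultra_nonempty[OF assms])+
    show "ultra_map (lsubst c) p \<in> lultra A False" if "c \<in> (\<Union>n. A n)" "p \<in> lultra A True" for c p
      using that ultra_map_lsubst_lultra[OF assms(1)] by blast
    show "ultra_map (lsubst c) p = p" if "p \<in> lultra A False" for c p
      using that by (rule ultra_map_lsubst_constant)
    show "ultra_map (lsubst c) (ultra_mult (++) p q) =
        ultra_mult (++) (ultra_map (lsubst c) p) (ultra_map (lsubst c) q)" for c p q
      by (simp add: ultra_map_def ultra_mult_def lsubst_map_add)
    show "ultra_mult (++) p q \<in> lultra A False" if "p \<in> lultra A False" "q \<in> lultra A False" for p q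
      using ultra_mult_lultra[OF that] by simp
    show "ultra_mult (++) p q \<in> lultra A True" if "p \<in> lultra A True" "q \<in> lultra A False" for p q
      using ultra_mult_lultra[OF that] by simp
    show "ultra_mult (++) p q \<in> lultra A True" if "p \<in> lultra A True" "q \<in> lultra A True" for p q
      using ultra_mult_lultra[OF that] by simp
    show "ultra_mult (++) p q \<in> lultra A True" if "p \<in> lultra A False" "q \<in> lultra A True" for p q
      using ultra_mult_lultra[OF that] by simp
  qed (rule that)
qed

text \<open>
  Choose \<open>u\<^sub>n\<close> such that all its instances lie in \<open>D\<^sub>n\<close> and can be prolonged inside \<open>D\<^sub>n\<close> by
  \<open>p\<close>-almost all words; \<open>D\<^sub>n\<^sub>+\<^sub>1\<close> consists of the words of \<open>D\<^sub>n\<close> satisfying \<open>B\<^sub>n\<^sub>+\<^sub>1\<close> that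
  prolong every instance of \<open>u\<^sub>n\<close> in this way.
\<close>

lemma lword_sequence:
  fixes B :: "nat \<Rightarrow> 'c lword \<Rightarrow> bool"
  assumes fin: "\<And>n. finite (A n)"
    and p: "p \<in> lultra A False" "ultra_mult (++) p p = p"
    and q: "q \<in> lultra A True" "\<forall>n. \<forall>c\<in>A n. ultra_map (lsubst c) q = p"
    and B: "\<And>n. p (B n)"
  shows "\<exists>u. (\<forall>n. lword A n (u n) \<and> variable_lword (u n)) \<and>
    (\<forall>n. \<forall>i\<in>dom (u n). \<forall>j\<in>dom (u (Suc n)). i < j) \<and>
    (\<forall>xs. xs \<noteq> [] \<and> sorted_wrt (<) (map fst xs) \<and> (\<forall>(n, c)\<in>set xs. c \<in> A n) \<longrightarrow>
      B (fst (hd xs)) (lprod u xs))"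
proof -
  note up = lultra_ultrafilter[OF p(1)] and uq = lultra_ultrafilter[OF q(1)]
  define good where "good n D v \<longleftrightarrow> lword A n v \<and> variable_lword v \<and>
      (\<forall>c\<in>A n. D (lsubst c v) \<and> p (\<lambda>w. D (lsubst c v ++ w)))" for n D v
  have good_ex: "\<exists>v. good n D v \<and> (\<forall>i\<in>dom v. m \<le> i)" if D: "p D" for n m D
  proof -
    have *: "q (\<lambda>v. D (lsubst c v) \<and> p (\<lambda>w. D (lsubst c v ++ w)))" if "c \<in> A n" for c
    proof -
      \<comment> \<open>By \<open>p = p p\<close>, almost every \<open>v\<close> can be prolonged
        inside the large set \<open>D\<close> by almost every \<open>w\<close>. Since
        \<open>lsubst c\<close> maps \<open>q\<close> to \<open>p\<close>, the same holds for the
        \<open>c\<close>-instance of \<open>q\<close>-almost every word.\<close>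
      have "p (\<lambda>v. p (\<lambda>w. D (v ++ w)))"
        using D fun_cong[OF p(2), of D] by (simp add: ultra_mult_def)
      then have "p (\<lambda>v. D v \<and> p (\<lambda>w. D (v ++ w)))"
        using D by (simp add: ultrafilter_conj[OF up])
      then show ?thesis
        using fun_cong[OF q(2)[rule_format, OF that], of "\<lambda>v. D v \<and> p (\<lambda>w. D (v ++ w))"]
        by (simp add: ultra_map_def)
    qed
    \<comment> \<open>Finiteness of \<open>A n\<close> lets one variable word serve all its
      letters.\<close>
    have "q (\<lambda>v. \<forall>c\<in>A n. D (lsubst c v) \<and> p (\<lambda>w. D (lsubst c v ++ w)))"
      by (rule ultrafilter_Ball[OF uq, OF fin *])
    then have "q (\<lambda>v. (lword A (max m n) v \<and> variable_lword v = True) \<and>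
        (\<forall>c\<in>A n. D (lsubst c v) \<and> p (\<lambda>w. D (lsubst c v ++ w))))"
      using lultra_lword[OF q(1), of "max m n"] unfolding ultrafilter_conj[OF uq] by blast
    then obtain v where v: "lword A (max m n) v" "variable_lword v"
        "\<forall>c\<in>A n. D (lsubst c v) \<and> p (\<lambda>w. D (lsubst c v ++ w))"
      using ultrafilter_ex[OF uq] by blast
    then have "lword A n v" "\<forall>i\<in>dom v. m \<le> i"
      using lword_antimono[of n "max m n" A v] by (auto simp: lword_def)
    with v show ?thesis
      unfolding good_def by blast
  qed
  define nxt where "nxt n D v = (\<lambda>w. (D w \<and> B (Suc n) w) \<and> (\<forall>c\<in>A n. D (lsubst c v ++ w)))" for n D v
  have p_nxt: "p (nxt n D v)" if "p D" "good n D v" for n D v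
  proof -
    have "p (\<lambda>w. \<forall>c\<in>A n. D (lsubst c v ++ w))"
      by (rule ultrafilter_Ball[OF up, OF fin]) (use that(2) in \<open>auto simp: good_def\<close>)
    then show ?thesis
      unfolding nxt_def ultrafilter_conj[OF up] using B that(1) by blast
  qed
  \<comment> \<open>A state consists of the current large set and the word chosen from it.\<close>
  define Inv where "Inv n s \<longleftrightarrow> p (fst s) \<and> (\<forall>w. fst s w \<longrightarrow> B n w) \<and> good n (fst s) (snd s)"
    for n :: nat and s :: "('c lword \<Rightarrow> bool) \<times> 'c lword"
  define Stp where "Stp n s t \<longleftrightarrow> fst t = nxt n (fst s) (snd s) \<and>
      (\<forall>i\<in>dom (snd s). \<forall>j\<in>dom (snd t). i < j)"
    for n :: nat and s t :: "('c lword \<Rightarrow> bool) \<times> 'c lword"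
  have "\<exists>S. \<forall>n. Inv n (S n) \<and> Stp n (S n) (S (Suc n))"
  proof (rule dependent_nat_choice)
    show "\<exists>s. Inv 0 s"
      using good_ex[OF B[of 0], of 0 0] B[of 0] unfolding Inv_def by auto
    fix s n assume s: "Inv n s"
    have "finite (dom (snd s))"
      using s by (simp add: Inv_def good_def lword_def)
    then obtain m where m: "\<forall>i\<in>dom (snd s). i < m"
      by (auto simp: finite_nat_set_iff_bounded)
    let ?D = "nxt n (fst s) (snd s)"
    have D: "p ?D"
      using s p_nxt by (simp add: Inv_def)
    then obtain v where v: "good (Suc n) ?D v" "\<forall>i\<in>dom v. m \<le> i"
      using good_ex by blast
    have "Inv (Suc n) (?D, v)"
      using D v by (simp add: Inv_def) (simp add: nxt_def)
    moreover have "Stp n s (?D, v)"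
      using m v by (auto simp: Stp_def intro: less_le_trans)
    ultimately show "\<exists>t. Inv (Suc n) t \<and> Stp n s t"
      by blast
  qed
  then obtain S where S: "\<And>n. Inv n (S n)" "\<And>n. Stp n (S n) (S (Suc n))"
    by blast
  define D where "D n = fst (S n)" for n
  define u where "u n = snd (S n)" for n
  have good: "good n (D n) (u n)" and DB: "D n w \<Longrightarrow> B n w" for n w
    using S(1)[of n] by (auto simp: Inv_def D_def u_def)
  have D_Suc: "D (Suc n) = nxt n (D n) (u n)" for n
    using S(2)[of n] by (simp add: Stp_def D_def u_def)
  have D_antimono: "m \<le> n \<Longrightarrow> D n w \<Longrightarrow> D m w" for m n w
    by (induction n rule: dec_induct) (auto simp: D_Suc nxt_def)
  have prod: "D n (lprod u ((n, c) # xs))"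
    if "sorted_wrt (<) (map fst ((n, c) # xs))" "\<forall>(i, a) \<in> set ((n, c) # xs). a \<in> A i" for n c xs
    using that
  proof (induction xs arbitrary: n c)
    case Nil
    then show ?case
      using good[of n] by (simp add: lprod_def good_def)
  next
    case (Cons x xs)
    obtain n' c' where x: "x = (n', c')"
      by (cases x)
    \<comment> \<open>The remaining product lies in \<open>D n'\<close>, which is contained in
      \<open>D (Suc n)\<close> because indices increase; membership there is what permits prefixing
      an instance of \<open>u n\<close>.\<close>
    have "D n' (lprod u ((n', c') # xs))"
      using Cons.prems x by (intro Cons.IH) auto
    moreover have "Suc n \<le> n'"
      using Cons.prems x by simp
    ultimately have "D (Suc n) (lprod u (x # xs))"
      using D_antimono x by blast
    then have "D n (lsubst c (u n) ++ lprod u (x # xs))"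
      using Cons.prems by (simp add: D_Suc nxt_def)
    then show ?case
      by (simp add: lprod_def)
  qed
  show ?thesis
  proof (intro exI[of _ u] conjI allI impI ballI)
    show "lword A n (u n)" "variable_lword (u n)" for n
      using good[of n] by (simp_all add: good_def)
    show "i < j" if "i \<in> dom (u n)" "j \<in> dom (u (Suc n))" for n i j
      using S(2)[of n] that by (simp add: Stp_def u_def)
    fix xs :: "(nat \<times> 'c) list"
    assume xs: "xs \<noteq> [] \<and> sorted_wrt (<) (map fst xs) \<and> (\<forall>(n, c)\<in>set xs. c \<in> A n)"
    then obtain n c ys where "xs = (n, c) # ys"
      by (metis list.exhaust surj_pair)
    with xs show "B (fst (hd xs)) (lprod u xs)"
      using DB[OF prod[of n c ys]] by simp
  qed
qed

theorem lword_convergence: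
  fixes f :: "'c lword \<Rightarrow> 'x"
  assumes metric: "Metric_space X d"
    and compact: "compact_space (Metric_space.mtopology X d)"
    and A: "mono A" "\<And>n. finite (A n)" "c0 \<in> A k0"
    and f: "\<forall>w. lword A 0 w \<and> \<not> variable_lword w \<longrightarrow> f w \<in> X"
  shows "\<exists>u. \<exists>x0\<in>X. (\<forall>n. lword A n (u n) \<and> variable_lword (u n)) \<and>
    (\<forall>n. \<forall>i\<in>dom (u n). \<forall>j\<in>dom (u (Suc n)). i < j) \<and>
    (\<forall>U. openin (Metric_space.mtopology X d) U \<and> x0 \<in> U \<longrightarrow>
      (\<exists>N. \<forall>xs. xs \<noteq> [] \<and> sorted_wrt (<) (map fst xs) \<and> (\<forall>(n, c)\<in>set xs. N \<le> n \<and> c \<in> A n) \<longrightarrow>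
        f (lprod u xs) \<in> U))"
proof -
  interpret Metric_space X d
    by (rule metric)
  obtain p q where p: "p \<in> lultra A False" "ultra_mult (++) p p = p"
    and q: "q \<in> lultra A True" "\<And>c. c \<in> (\<Union>n. A n) \<Longrightarrow> ultra_map (lsubst c) q = p"
    using lultra_idempotent[OF A(1,3)] by metis
  note up = lultra_ultrafilter[OF p(1)]
  have "p (\<lambda>w. f w \<in> X)"
    using ultrafilter_mono[OF up, OF lultra_lword[OF p(1), of 0]] f by simp
  then obtain x0 where x0: "x0 \<in> X" "\<And>U. openin mtopology U \<Longrightarrow> x0 \<in> U \<Longrightarrow> p (\<lambda>w. f w \<in> U)"
    using ultrafilter_limit[OF compact up, of f] by auto
  \<comment> \<open>Balls of radius \<open>1/(n+1)\<close> form a countable neighbourhood base at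
    \<open>x0\<close>, so a single recursion gives convergence as the first index of a product
    grows.\<close>
  define B where "B n w \<longleftrightarrow> f w \<in> mball x0 (inverse (real (Suc n)))" for n w
  have pB: "p (B n)" for n
    unfolding B_def using x0 by (intro x0(2)) auto
  have q': "\<forall>n. \<forall>c\<in>A n. ultra_map (lsubst c) q = p"
    using q(2) by blast
  obtain u where u: "\<forall>n. lword A n (u n) \<and> variable_lword (u n)"
    "\<forall>n. \<forall>i\<in>dom (u n). \<forall>j\<in>dom (u (Suc n)). i < j"
    and prod: "\<forall>xs. xs \<noteq> [] \<and> sorted_wrt (<) (map fst xs) \<and> (\<forall>(n, c)\<in>set xs. c \<in> A n) \<longrightarrow>
      B (fst (hd xs)) (lprod u xs)"
    using lword_sequence[of A p q B, OF A(2) p q(1) q' pB] by (elim exE conjE)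
  have "\<exists>N. \<forall>xs. xs \<noteq> [] \<and> sorted_wrt (<) (map fst xs) \<and> (\<forall>(n, c)\<in>set xs. N \<le> n \<and> c \<in> A n) \<longrightarrow>
      f (lprod u xs) \<in> U" if U: "openin mtopology U" "x0 \<in> U" for U
  proof -
    obtain r where r: "r > 0" "mball x0 r \<subseteq> U"
      using U by (auto simp: openin_mtopology)
    then obtain N where N: "inverse (real (Suc N)) < r"
      using reals_Archimedean by blast
    have "f (lprod u xs) \<in> U" if xs: "xs \<noteq> []" "sorted_wrt (<) (map fst xs)"
      "\<forall>(n, c)\<in>set xs. N \<le> n \<and> c \<in> A n" for xs
    proof -
      have "B (fst (hd xs)) (lprod u xs)"
        using xs by (intro prod[rule_format]) auto
      moreover have "N \<le> fst (hd xs)"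
        using xs(3) hd_in_set[OF xs(1)] by auto
      then have "inverse (real (Suc (fst (hd xs)))) \<le> inverse (real (Suc N))"
        by (intro le_imp_inverse_le) auto
      ultimately have "f (lprod u xs) \<in> mball x0 r"
        using N unfolding B_def in_mball by linarith
      with r(2) show ?thesis
        by (rule subsetD)
    qed
    then show ?thesis
      by blast
  qed
  with u x0(1) show ?thesis
    by (intro exI[of _ u] bexI[of _ x0]) auto
qed


subsection \<open>Decoding\<close>

lemma star_list_simps [simp]:
  "star_list [] = Map.empty"
  "star_list (w # ws) = w ++ star_list ws"
  by (simp_all add: star_list_def star_def)

lemma star_list_append: "star_list (vs @ ws) = star_list vs ++ star_list ws"
  by (induction vs) simp_all

lemma dom_star_list: "dom (star_list ws) = (\<Union>w\<in>set ws. dom w)"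
  by (induction ws) auto

lemma star_list_SomeD: "star_list ws i = Some a \<Longrightarrow> \<exists>w\<in>set ws. w i = Some a"
  by (induction ws) (auto simp: map_add_Some_iff)

text \<open>The common form of \<open>less_R1\<close> and \<open>less_R2\<close>: on each side,
  positions move outward from \<open>0\<close>.\<close>

definition precedes :: "'a word \<Rightarrow> 'a word \<Rightarrow> bool" where
  "precedes v w \<longleftrightarrow> (\<forall>i\<in>dom v. \<forall>j\<in>dom w. if 0 < j then i < j else j < i)"

text \<open>
  One-sided words are the case \<open>S = {1}\<close> and two-sided words the case \<open>S = {-1, 1}\<close>, where
  \<open>S\<close> is the set of signs of the positions at which the variable has to occur; \<open>\<beta> c i\<close> is the
  letter that the substitution \<open>c\<close> puts at position \<open>i\<close>.
\<close>

locale word_substitution =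
  fixes \<alpha> :: "int \<Rightarrow> 'a" and k :: "int \<Rightarrow> nat" and \<upsilon> :: 'a
    and \<beta> :: "'c \<Rightarrow> int \<Rightarrow> 'a" and A :: "nat \<Rightarrow> 'c set" and S :: "int set"
  assumes S: "1 \<in> S" "S \<subseteq> {-1, 1}"
    and A_0: "A 0 = {}" and mono_A: "mono A" and finite_A: "finite (A n)" and A_1: "A 1 \<noteq> {}"
    and \<beta>: "c \<in> A n \<Longrightarrow> int n \<le> \<bar>i\<bar> \<Longrightarrow> sgn i \<in> S \<Longrightarrow> \<beta> c i \<in> letters_at \<alpha> k i"
    and \<upsilon>: "\<upsilon> \<notin> alphabet \<alpha>"
begin

definition subst :: "'a word \<Rightarrow> 'c option \<Rightarrow> 'a word" where
  "subst w c = (case c of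
       None \<Rightarrow> w
     | Some b \<Rightarrow> (\<lambda>i. if w i = Some \<upsilon> then Some (\<beta> b i) else w i))"

definition words :: "'a word set" where
  "words = {w \<in> words2 \<alpha> k. sgn ` dom w \<subseteq> S}"

definition var_word :: "'a word \<Rightarrow> bool" where
  "var_word w \<longleftrightarrow> w \<in> var_words \<alpha> k \<upsilon> \<and> sgn ` dom w \<subseteq> S \<and> S \<subseteq> sgn ` {i. w i = Some \<upsilon>}"

definition seqs :: "(nat \<Rightarrow> 'a word) set" where
  "seqs = {w. \<forall>n\<ge>1. var_word (w n) \<and> precedes (w n) (w (Suc n))}"

definition E :: "(nat \<Rightarrow> 'a word) \<Rightarrow> 'a word set" where
  "E w = {star_list (map (\<lambda>(n, c). subst (w n) c) xs) | xs.
     xs \<noteq> [] \<and> sorted_wrt (<) (map fst xs) \<and> (\<forall>(n, c)\<in>set xs. n \<ge> 1 \<and> c \<in> Some ` A n)}"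

definition EV :: "(nat \<Rightarrow> 'a word) \<Rightarrow> 'a word set" where
  "EV w = {star_list (map (\<lambda>(n, c). subst (w n) c) xs) | xs.
     xs \<noteq> [] \<and> sorted_wrt (<) (map fst xs) \<and>
     (\<forall>(n, c)\<in>set xs. n \<ge> 1 \<and> c \<in> Some ` A n \<union> {None}) \<and> (\<exists>(n, c)\<in>set xs. c = None)}"

section \<open>Substitution in words with integer positions\<close>

lemma dom_subst [simp]: "dom (subst w c) = dom w"
  by (auto simp: subst_def dom_def split: option.splits if_splits)

lemma subst_None [simp]: "subst w None = w"
  by (simp add: subst_def)

lemma subst_map_add: "subst (v ++ w) (Some c) = subst v (Some c) ++ subst w (Some c)"
  by (auto simp: subst_def map_add_def split: option.splits)

lemma subst_star_list: "subst (star_list ws) (Some c) = star_list (map (\<lambda>w. subst w (Some c)) ws)"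
proof (induction ws)
  case Nil
  show ?case
    by (simp add: subst_def)
qed (simp add: subst_map_add)

lemma var_word_finite: "var_word w \<Longrightarrow> finite (dom w)"
  by (simp add: var_word_def var_words_def)

lemma var_word_sgn: "var_word w \<Longrightarrow> i \<in> dom w \<Longrightarrow> i \<noteq> 0 \<and> sgn i \<in> S"
  by (auto simp: var_word_def var_words_def)

lemma var_word_variable: "var_word w \<Longrightarrow> s \<in> S \<Longrightarrow> \<exists>i. w i = Some \<upsilon> \<and> sgn i = s"
  by (auto simp: var_word_def)

lemma var_word_letter: "var_word w \<Longrightarrow> w i = Some a \<Longrightarrow> a \<noteq> \<upsilon> \<Longrightarrow> a \<in> letters_at \<alpha> k i"
  by (force simp: var_word_def var_words_def)

lemma letters_not_variable: "a \<in> letters_at \<alpha> k i \<Longrightarrow> a \<noteq> \<upsilon>"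
  using \<upsilon> by (auto simp: letters_at_def alphabet_def split: if_splits)

lemma E_finite:
  assumes "u \<in> seqs" "v \<in> E u"
  shows "finite (dom v)"
  using assms var_word_finite unfolding E_def seqs_def by (fastforce simp: dom_star_list)

section \<open>Decoding along a fixed sequence\<close>

context
  fixes w :: "nat \<Rightarrow> 'a word"
  assumes w: "w \<in> seqs"
begin

lemma var_word_seq: "n \<ge> 1 \<Longrightarrow> var_word (w n)"
  using w by (simp add: seqs_def)

lemma seq_same_sign:
  assumes "m \<ge> 1" "n \<ge> 1" "i \<in> dom (w m)"
  shows "\<exists>j\<in>dom (w n). sgn j = sgn i"
  using var_word_variable[OF var_word_seq[OF assms(2)], of "sgn i"]
    var_word_sgn[OF var_word_seq[OF assms(1)] assms(3)] by blast

text \<open>The relation \<open>precedes\<close> is not transitive in general, since the middle word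
  might have no position on the side of \<open>j\<close>. In a sequence every word has positions of
  each sign in \<open>S\<close>, and such a position links the two inequalities.\<close>

lemma precedes_seq:
  assumes "1 \<le> m" "m < n"
  shows "precedes (w m) (w n)"
  using assms(2)
proof (induction n)
  case (Suc n)
  have step: "precedes (w n) (w (Suc n))" if "n \<ge> 1"
    using w that by (simp add: seqs_def)
  show ?case
  proof (cases "m = n")
    case False
    then have IH: "precedes (w m) (w n)" and n: "n \<ge> 1"
      using Suc assms(1) by auto
    show ?thesis
      unfolding precedes_def
    proof (intro ballI)
      fix i j assume i: "i \<in> dom (w m)" and j: "j \<in> dom (w (Suc n))"
      obtain l where l: "l \<in> dom (w n)" "sgn l = sgn j"
        using seq_same_sign[of "Suc n" n j] j n by auto
      have "if 0 < l then i < l else l < i" "if 0 < j then l < j else j < l"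
        using IH step[OF n] i j l(1) by (auto simp: precedes_def)
      then show "if 0 < j then i < j else j < i"
        using l(2) by (auto simp: sgn_if split: if_splits)
    qed
  qed (use step assms(1) in simp)
qed simp

text \<open>On each side, positions move outward by at least one at every step. By the assumption on
  \<open>\<beta>\<close>, a substitution allowed for index \<open>n\<close> is therefore admissible
  at all positions of \<open>w n\<close>.\<close>

lemma index_le_abs:
  assumes "n \<ge> 1" "i \<in> dom (w n)"
  shows "int n \<le> \<bar>i\<bar>"
  using assms
proof (induction n arbitrary: i rule: nat_induct_at_least)
  case base
  then show ?case
    using var_word_sgn[OF var_word_seq] by force
next
  case (Suc n)
  then obtain j where j: "j \<in> dom (w n)" "sgn j = sgn i"
    using seq_same_sign[of "Suc n" n i] by auto
  have "if 0 < i then j < i else i < j"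
    using w Suc.hyps Suc.prems j(1) by (auto simp: seqs_def precedes_def)
  moreover have "int n \<le> \<bar>j\<bar>"
    using Suc.IH j(1) by blast
  ultimately show ?case
    using j(2) by (auto simp: sgn_if split: if_splits)
qed

text \<open>An inserted letter belongs to the alphabet and so differs from the variable; a second
  substitution cannot change it.\<close>

lemma subst_subst:
  assumes "n \<ge> 1" "\<And>b. a = Some b \<Longrightarrow> b \<in> A n"
  shows "subst (subst (w n) a) (Some c) = subst (w n) (Some (case a of None \<Rightarrow> c | Some b \<Rightarrow> b))"
proof (cases a)
  case (Some b)
  have "\<beta> b i \<noteq> \<upsilon>" if "w n i = Some \<upsilon>" for i
    using that assms Some var_word_sgn[OF var_word_seq[OF assms(1)], of i]
      index_le_abs[OF assms(1), of i] \<beta>[of b n i] letters_not_variable by blast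
  with Some show ?thesis
    by (auto simp: subst_def)
qed simp

text \<open>\<open>None\<close> is already the substitution that keeps the variable, so values of
  \<open>g\<close> are passed to \<open>subst\<close> unchanged. The increasing list of indices
  matches the form required in \<open>EV\<close>.\<close>

definition decode :: "'c lword \<Rightarrow> 'a word" where
  "decode g = star_list (map (\<lambda>n. subst (w n) (the (g n))) (sorted_list_of_set (dom g)))"

lemma decode_empty [simp]: "decode Map.empty = Map.empty"
  by (simp add: decode_def)

lemma dom_decode: "finite (dom g) \<Longrightarrow> dom (decode g) = (\<Union>n\<in>dom g. dom (w n))"
  by (simp add: decode_def dom_star_list)

lemma decode_SomeD:
  assumes "finite (dom g)" "decode g i = Some a"
  obtains n c where "g n = Some c" "subst (w n) c i = Some a"
proof -
  obtain n where "n \<in> dom g" "subst (w n) (the (g n)) i = Some a"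
    using star_list_SomeD[OF assms(2)[unfolded decode_def]] assms(1) by auto
  with that show thesis
    by auto
qed

text \<open>The order of the indices makes the sorted list of the union a concatenation; the two
  halves then agree factor by factor.\<close>

lemma decode_map_add:
  assumes "finite (dom g)" "finite (dom h)" "\<And>i j. i \<in> dom g \<Longrightarrow> j \<in> dom h \<Longrightarrow> i < j"
  shows "decode (g ++ h) = decode g ++ decode h"
proof -
  have "sorted_list_of_set (dom (g ++ h)) =
      sorted_list_of_set (dom g) @ sorted_list_of_set (dom h)"
  proof (rule sorted_distinct_set_unique)
    show "sorted (sorted_list_of_set (dom g) @ sorted_list_of_set (dom h))"
      using assms by (auto simp: sorted_append intro: less_imp_le)
    show "distinct (sorted_list_of_set (dom g) @ sorted_list_of_set (dom h))"
      using assms by auto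
  qed (use assms in auto)
  moreover have "map (\<lambda>n. subst (w n) (the ((g ++ h) n))) (sorted_list_of_set (dom g)) =
      map (\<lambda>n. subst (w n) (the (g n))) (sorted_list_of_set (dom g))"
  proof (rule map_cong)
    fix n assume "n \<in> set (sorted_list_of_set (dom g))"
    then have "n \<notin> dom h"
      using assms by auto
    then show "subst (w n) (the ((g ++ h) n)) = subst (w n) (the (g n))"
      by (simp add: map_add_dom_app_simps)
  qed simp
  moreover have "map (\<lambda>n. subst (w n) (the ((g ++ h) n))) (sorted_list_of_set (dom h)) =
      map (\<lambda>n. subst (w n) (the (h n))) (sorted_list_of_set (dom h))"
    using assms by (intro map_cong) (auto simp: map_add_dom_app_simps)
  ultimately show ?thesis
    by (simp only: decode_def map_append star_list_append)
qed

text \<open>Lets an instance of an extracted word be computed in coded form, so that products of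
  such instances are decodings of \<open>lprod\<close>.\<close>

lemma subst_decode:
  assumes "lword A 1 g"
  shows "subst (decode g) (Some c) = decode (lsubst c g)"
proof -
  have "subst (subst (w n) (the (g n))) (Some c) = subst (w n) (the (lsubst c g n))"
    if n: "n \<in> dom g" for n
  proof -
    obtain a where a: "g n = Some a"
      using n by blast
    have "n \<ge> 1" "\<And>b. a = Some b \<Longrightarrow> b \<in> A n"
      using assms n a by (auto simp: lword_def)
    then show ?thesis
      by (simp add: a subst_subst lsubst_def)
  qed
  then have "map ((\<lambda>v. subst v (Some c)) \<circ> (\<lambda>n. subst (w n) (the (g n)))) (sorted_list_of_set (dom g)) =
      map (\<lambda>n. subst (w n) (the (lsubst c g n))) (sorted_list_of_set (dom g))"
    using assms by (intro map_cong) (auto simp: lword_def)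
  then show ?thesis
    by (simp only: decode_def subst_star_list map_map dom_lsubst)
qed

lemma decode_letter:
  assumes "lword A 1 g" "decode g i = Some a"
  shows "i \<noteq> 0" "sgn i \<in> S" "a \<noteq> \<upsilon> \<or> \<not> variable_lword g \<Longrightarrow> a \<in> letters_at \<alpha> k i"
proof -
  have "finite (dom g)"
    using assms(1) by (simp add: lword_def)
  then obtain n c where n: "g n = Some c" "subst (w n) c i = Some a"
    using assms(2) by (rule decode_SomeD)
  have n1: "n \<ge> 1"
    using assms(1) n(1) by (auto simp: lword_def)
  have i: "i \<in> dom (w n)"
    using n(2) dom_subst by blast
  show "i \<noteq> 0" "sgn i \<in> S"
    using var_word_sgn[OF var_word_seq[OF n1] i] by auto
  then have \<beta>_letter: "c = Some b \<Longrightarrow> \<beta> b i \<in> letters_at \<alpha> k i" for b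
    using \<beta>[of b n i] assms(1) n(1) index_le_abs[OF n1 i] by (auto simp: lword_def)
  show "a \<in> letters_at \<alpha> k i" if "a \<noteq> \<upsilon> \<or> \<not> variable_lword g"
  proof (cases c)
    case None
    then have "a \<noteq> \<upsilon>"
      using that n(1) by (auto simp: variable_lword_def)
    then show ?thesis
      using var_word_letter[OF var_word_seq[OF n1], of i a] n(2) None by simp
  next
    case (Some b)
    then show ?thesis
      using var_word_letter[OF var_word_seq[OF n1], of i a] n(2) \<beta>_letter
      by (auto simp: subst_def split: if_splits)
  qed
qed

lemma decode_dom:
  assumes "lword A 1 g"
  shows "finite (dom (decode g))" "dom (decode g) \<noteq> {}"
proof -
  have g: "finite (dom g)" "dom g \<noteq> {}" "dom g \<subseteq> {1..}"
    using assms by (auto simp: lword_def)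
  show "finite (dom (decode g))"
    using g var_word_finite[OF var_word_seq] by (auto simp: dom_decode)
  obtain n where "n \<in> dom g" "n \<ge> 1"
    using g(2,3) by (meson all_not_in_conv atLeast_iff subsetD)
  then show "dom (decode g) \<noteq> {}"
    using g(1) var_word_variable[OF var_word_seq S(1), of n] by (force simp: dom_decode)
qed

lemma decode_in_words:
  assumes "lword A 1 g" "\<not> variable_lword g"
  shows "decode g \<in> words"
proof -
  have "\<forall>i\<in>dom (decode g). i \<noteq> 0 \<and> sgn i \<in> S \<and> the (decode g i) \<in> letters_at \<alpha> k i"
    using decode_letter[OF assms(1)] assms(2) by auto
  then show ?thesis
    using decode_dom[OF assms(1)] by (auto simp: words_def words2_def)
qed

lemma decode_var_word:
  assumes "lword A 1 g" "variable_lword g"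
  shows "var_word (decode g)"
proof -
  have *: "\<forall>i\<in>dom (decode g). i \<noteq> 0 \<and> sgn i \<in> S \<and> the (decode g i) \<in> insert \<upsilon> (letters_at \<alpha> k i)"
    using decode_letter[OF assms(1)] by (metis domD insert_iff option.sel)
  obtain n where n: "g n = Some None"
    using assms(2) by (auto simp: variable_lword_def)
  have fin: "finite (dom g)" and n1: "n \<ge> 1"
    using assms(1) n by (auto simp: lword_def)
  have "decode g i = Some \<upsilon>" if i: "w n i = Some \<upsilon>" for i
  proof -
    have "i \<in> dom (decode g)"
      using n i fin by (auto simp: dom_decode)
    then obtain a where a: "decode g i = Some a"
      by blast
    obtain m c where m: "g m = Some c" "subst (w m) c i = Some a"
      using fin a by (rule decode_SomeD)
    have m1: "m \<ge> 1"
      using assms(1) m(1) by (auto simp: lword_def)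
    have im: "i \<in> dom (w m)"
      using m(2) dom_subst by blast
    \<comment> \<open>Distinct words of the sequence have disjoint domains, so no other factor can
      override the variable coming from \<open>w n\<close>.\<close>
    have "m = n"
    proof (rule ccontr)
      assume "m \<noteq> n"
      then have "precedes (w m) (w n) \<or> precedes (w n) (w m)"
        using precedes_seq m1 n1 by (meson nat_neq_iff)
      then show False
        using im i by (auto simp: precedes_def split: if_splits)
    qed
    then show ?thesis
      using a m n i by simp
  qed
  then have "S \<subseteq> sgn ` {i. decode g i = Some \<upsilon>}"
    using var_word_variable[OF var_word_seq[OF n1]] by (metis (mono_tags, lifting) image_eqI mem_Collect_eq subsetI)
  moreover from this obtain i where "decode g i = Some \<upsilon>"
    using S(1) by blast
  ultimately show ?thesis
    using decode_dom[OF assms(1)] * unfolding var_word_def var_words_def by auto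
qed

lemma decode_in_EV:
  assumes "lword A 1 g" "variable_lword g"
  shows "decode g \<in> EV w"
proof -
  let ?xs = "map (\<lambda>n. (n, the (g n))) (sorted_list_of_set (dom g))"
  have g: "finite (dom g)" "dom g \<noteq> {}" "dom g \<subseteq> {1..}"
    using assms by (auto simp: lword_def)
  have "decode g = star_list (map (\<lambda>(n, c). subst (w n) c) ?xs)"
    by (simp add: decode_def comp_def)
  moreover have "?xs \<noteq> []" "sorted_wrt (<) (map fst ?xs)"
    using g by (simp_all add: comp_def)
  moreover have "\<forall>(n, c)\<in>set ?xs. n \<ge> 1 \<and> c \<in> Some ` A n \<union> {None}"
  proof clarify
    fix n c assume "(n, c) \<in> set ?xs"
    then have "g n = Some c"
      using g(1) by auto
    then show "n \<ge> 1 \<and> c \<in> Some ` A n \<union> {None}"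
      using assms(1) by (cases c) (auto simp: lword_def)
  qed
  moreover have "\<exists>(n, c)\<in>set ?xs. c = None"
    using assms(2) g(1) by (force simp: variable_lword_def)
  ultimately show ?thesis
    unfolding EV_def by blast
qed

lemma decode_precedes:
  assumes "lword A 1 g" "lword A 1 h" "\<forall>i\<in>dom g. \<forall>j\<in>dom h. i < j"
  shows "precedes (decode g) (decode h)"
  unfolding precedes_def
proof (intro ballI)
  fix i j assume "i \<in> dom (decode g)" "j \<in> dom (decode h)"
  then obtain m n where m: "m \<in> dom g" "i \<in> dom (w m)" and n: "n \<in> dom h" "j \<in> dom (w n)"
    using assms(1,2) by (auto simp: dom_decode lword_def)
  then have "precedes (w m) (w n)"
    using assms by (intro precedes_seq) (auto simp: lword_def)
  then show "if 0 < j then i < j else j < i"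
    using m n unfolding precedes_def by blast
qed

text \<open>Tails are measured by positive positions, which both kinds of words possess since
  \<open>1\<close> lies in \<open>S\<close>. Such a tail forces large indices, because finitely many
  words occupy only bounded positions.\<close>

theorem convergent_extraction:
  fixes x :: "'a word \<Rightarrow> 'x"
  assumes metric: "Metric_space X d"
    and compact: "compact_space (Metric_space.mtopology X d)"
    and x: "x \<in> words \<rightarrow> X"
  shows "\<exists>u. \<exists>x0\<in>X. u \<in> seqs \<and> (\<forall>n\<ge>1. u n \<in> EV w) \<and>
    (\<forall>U. openin (Metric_space.mtopology X d) U \<and> x0 \<in> U \<longrightarrow>
      (\<exists>n0::nat. n0 \<ge> 1 \<and> (\<forall>v\<in>E u. (\<forall>i\<in>dom v. 0 < i \<longrightarrow> int n0 \<le> i) \<longrightarrow> x v \<in> U)))"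
proof -
  obtain c0 where "c0 \<in> A 1"
    using A_1 by blast
  \<comment> \<open>A constant coded word has no value at index \<open>0\<close>: \<open>A 0\<close>
    is empty and the variable is excluded.\<close>
  have lword_1: "lword A 1 g" if "lword A 0 g" "\<not> variable_lword g" for g
  proof -
    have "g 0 \<noteq> Some (Some c)" "g 0 \<noteq> Some None" for c
      using that A_0 by (auto simp: lword_def variable_lword_def)
    then have "0 \<notin> dom g"
      by (metis domD not_None_eq)
    then have "dom g \<subseteq> {1..}"
      by (metis One_nat_def Suc_leI atLeast_iff gr0I subsetI)
    then show ?thesis
      using that(1) by (simp add: lword_def)
  qed
  have "\<forall>g. lword A 0 g \<and> \<not> variable_lword g \<longrightarrow> x (decode g) \<in> X"
    using x decode_in_words lword_1 by blast
  from lword_convergence[OF metric compact mono_A finite_A \<open>c0 \<in> A 1\<close>, of "\<lambda>g. x (decode g)", OF this]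
  obtain u x0 where x0: "x0 \<in> X"
    and u: "\<forall>n. lword A n (u n) \<and> variable_lword (u n)"
    and ord: "\<forall>n. \<forall>i\<in>dom (u n). \<forall>j\<in>dom (u (Suc n)). i < j"
    and conv: "\<forall>U. openin (Metric_space.mtopology X d) U \<and> x0 \<in> U \<longrightarrow>
      (\<exists>N. \<forall>xs. xs \<noteq> [] \<and> sorted_wrt (<) (map fst xs) \<and> (\<forall>(n, c)\<in>set xs. N \<le> n \<and> c \<in> A n) \<longrightarrow>
        x (decode (lprod u xs)) \<in> U)"
    by (elim exE bexE conjE)
  \<comment> \<open>The word \<open>u 0\<close> might use index \<open>0\<close>, at which
    \<open>w\<close> is unconstrained; later words start at \<open>1\<close> or beyond.\<close>
  have u1: "lword A 1 (u n)" if "n \<ge> 1" for n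
    using u that lword_antimono by blast
  have fin: "finite (dom (u n))" for n
    using u by (simp add: lword_def)
  define u' where "u' n = decode (u n)" for n
  have seq: "u' \<in> seqs"
    unfolding seqs_def u'_def mem_Collect_eq
  proof (intro allI impI conjI)
    fix n :: nat assume "n \<ge> 1"
    then show "var_word (decode (u n))"
      using u u1 by (intro decode_var_word) auto
    show "precedes (decode (u n)) (decode (u (Suc n)))"
      using u1 ord \<open>n \<ge> 1\<close> by (intro decode_precedes) auto
  qed
  have EV: "u' n \<in> EV w" if "n \<ge> 1" for n
    unfolding u'_def using u u1[OF that] by (intro decode_in_EV) auto
  have ord': "i < j" if "m < n" "i \<in> dom (u m)" "j \<in> dom (u n)" for m n i j
    using that
  proof (induction n arbitrary: j)
    case (Suc n)
    show ?case
    proof (cases "m = n")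
      case False
      obtain l where "l \<in> dom (u n)"
        using u unfolding lword_def by blast
      then show ?thesis
        using Suc False ord by (meson less_SucE less_trans)
    qed (use Suc.prems ord in blast)
  qed simp
  have dom_lprod: "dom (lprod u xs) = (\<Union>(n, c)\<in>set xs. dom (u n))" for xs
    by (induction xs) (simp_all add: lprod_def split_beta Un_commute)
  have decode_lprod: "decode (lprod u xs) = star_list (map (\<lambda>(n, c). subst (u' n) (Some c)) xs)"
    if "sorted_wrt (<) (map fst xs)" "\<forall>(n, c)\<in>set xs. n \<ge> 1" for xs
    using that
  proof (induction xs)
    case (Cons y xs)
    obtain n c where y: "y = (n, c)"
      by (cases y)
    have "decode (lsubst c (u n) ++ lprod u xs) = decode (lsubst c (u n)) ++ decode (lprod u xs)"
    proof (rule decode_map_add)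
      show "finite (dom (lprod u xs))"
        using fin by (auto simp: dom_lprod)
      show "i < j" if ij: "i \<in> dom (lsubst c (u n))" "j \<in> dom (lprod u xs)" for i j
      proof -
        obtain m b where "(m, b) \<in> set xs" "j \<in> dom (u m)"
          using ij(2) by (auto simp: dom_lprod)
        moreover from this have "n < m"
          using Cons.prems(1) y by force
        ultimately show ?thesis
          using ij(1) ord' by simp
      qed
    qed (simp add: fin)
    then show ?case
      using Cons y subst_decode[OF u1] by (simp add: lprod_def u'_def)
  qed (simp add: lprod_def)
  have "\<exists>n0::nat. n0 \<ge> 1 \<and> (\<forall>v\<in>E u'. (\<forall>i\<in>dom v. 0 < i \<longrightarrow> int n0 \<le> i) \<longrightarrow> x v \<in> U)"
    if U: "openin (Metric_space.mtopology X d) U \<and> x0 \<in> U" for U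
  proof -
    obtain N where N: "\<forall>xs. xs \<noteq> [] \<and> sorted_wrt (<) (map fst xs) \<and>
        (\<forall>(n, c)\<in>set xs. N \<le> n \<and> c \<in> A n) \<longrightarrow> x (decode (lprod u xs)) \<in> U"
      using conv U by blast
    \<comment> \<open>A factor with index below \<open>N\<close> has a positive position below
      \<open>b\<close>, so requiring positive positions to be at least \<open>Suc b\<close> excludes
      it. Negative positions become \<open>0\<close> under \<open>nat\<close> and do no
      harm.\<close>
    have "finite (nat ` (\<Union>n\<in>{1..<N}. dom (u' n)))"
      using seq var_word_finite by (auto simp: seqs_def)
    then obtain b where b: "\<forall>j\<in>nat ` (\<Union>n\<in>{1..<N}. dom (u' n)). j < b"
      by (auto simp: finite_nat_set_iff_bounded)
    have "x v \<in> U" if v: "v \<in> E u'" "\<forall>i\<in>dom v. 0 < i \<longrightarrow> int (Suc b) \<le> i" for v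
    proof -
      obtain xs where xs: "v = star_list (map (\<lambda>(n, c). subst (u' n) c) xs)" "xs \<noteq> []"
        "sorted_wrt (<) (map fst xs)" "\<forall>(n, c)\<in>set xs. n \<ge> 1 \<and> c \<in> Some ` A n"
        using v(1) unfolding E_def by blast
      define ys where "ys = map (\<lambda>(n, c). (n, the c)) xs"
      have "map fst ys = map fst xs"
        by (simp add: ys_def comp_def case_prod_beta)
      moreover have "map (\<lambda>(n, c). subst (u' n) (Some c)) ys = map (\<lambda>(n, c). subst (u' n) c) xs"
        using xs(4) by (auto simp: ys_def)
      moreover have ys1: "\<forall>(n, c)\<in>set ys. n \<ge> 1 \<and> c \<in> A n"
        using xs(4) by (auto simp: ys_def)
      moreover from ys1 have "\<forall>(n, c)\<in>set ys. n \<ge> 1"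
        by blast
      ultimately have eq: "v = decode (lprod u ys)" and sorted: "sorted_wrt (<) (map fst ys)"
        using xs(1,3) decode_lprod[of ys] by simp_all
      have "N \<le> n" if "(n, c) \<in> set ys" for n c
      proof (rule ccontr)
        assume "\<not> N \<le> n"
        have n1: "n \<ge> 1"
          using ys1 that by blast
        then have "var_word (u' n)"
          using seq by (simp add: seqs_def)
        then obtain i where i: "i \<in> dom (u' n)" "sgn i = 1"
          using var_word_variable[OF _ S(1)] by blast
        have "(n, Some c) \<in> set xs"
          using that xs(4) by (auto simp: ys_def)
        then have "subst (u' n) (Some c) \<in> set (map (\<lambda>(n, c). subst (u' n) c) xs)"
          by (force simp: image_iff)
        moreover have "i \<in> dom (subst (u' n) (Some c))"
          unfolding dom_subst by (rule i(1))
        ultimately have "i \<in> dom v"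
          unfolding xs(1) dom_star_list by (rule UN_I[where B = dom])
        then have "int (Suc b) \<le> i"
          using v(2) i(2) by (simp add: sgn_if split: if_splits)
        moreover have "n \<in> {1..<N}"
          using n1 \<open>\<not> N \<le> n\<close> by simp
        then have "nat i < b"
          using b i(1) by blast
        ultimately show False
          by linarith
      qed
      then have "\<forall>(n, c)\<in>set ys. N \<le> n \<and> c \<in> A n"
        using ys1 by blast
      moreover have "ys \<noteq> []"
        using xs(2) by (simp add: ys_def)
      ultimately show ?thesis
        using N sorted unfolding eq by blast
    qed
    then show ?thesis
      by (intro exI[of _ "Suc b"]) auto
  qed
  then show ?thesis
    using x0 seq EV by blast
qed

end

end


subsection \<open>The two kinds of words\<close>

text \<open>Allowing no letter at \<open>0\<close> keeps constant words away from the unused index \<open>0\<close>.\<close>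

definition choice_set2 :: "(int \<Rightarrow> nat) \<Rightarrow> nat \<Rightarrow> (nat \<times> nat) set" where
  "choice_set2 k n = (if n = 0 then {} else {1..k (int n)} \<times> {1..k (- int n)})"

definition letter2 :: "(int \<Rightarrow> 'a) \<Rightarrow> nat \<times> nat \<Rightarrow> int \<Rightarrow> 'a" where
  "letter2 \<alpha> c i = (if i > 0 then \<alpha> (int (fst c)) else \<alpha> (- int (snd c)))"

definition choice_set1 :: "(int \<Rightarrow> nat) \<Rightarrow> nat \<Rightarrow> nat set" where
  "choice_set1 k n = (if n = 0 then {} else {1..k (int n)})"

text \<open>Growth of \<open>k\<close> away from \<open>0\<close> on each side gives both the
  monotonicity of the choice sets and the admissibility of a letter chosen for index
  \<open>n\<close> at positions at distance at least \<open>n\<close> from \<open>0\<close>.\<close>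

lemma word_substitution2:
  assumes k_pos: "\<forall>n. n \<noteq> 0 \<longrightarrow> k n \<ge> 1"
    and k_mono: "mono_on {1..} k" "mono_on {1..} (\<lambda>n. k (- n))"
    and variable: "\<upsilon> \<notin> alphabet \<alpha>"
  shows "word_substitution \<alpha> k \<upsilon> (letter2 \<alpha>) (choice_set2 k) {-1, 1}"
proof
  show "mono (choice_set2 k)"
  proof (rule monoI)
    fix m n :: nat assume "m \<le> n"
    then show "choice_set2 k m \<subseteq> choice_set2 k n"
      using monotone_onD[OF k_mono(1), of "int m" "int n"] monotone_onD[OF k_mono(2), of "int m" "int n"]
      by (auto simp: choice_set2_def)
  qed
  show "choice_set2 k 1 \<noteq> {}"
    using k_pos by (auto simp: choice_set2_def)
  fix c n i assume c: "c \<in> choice_set2 k n" and i: "int n \<le> \<bar>i\<bar>" "sgn i \<in> {-1, 1}"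
  obtain p q where pq: "c = (p, q)" "n \<noteq> 0" "1 \<le> p" "p \<le> k (int n)" "1 \<le> q" "q \<le> k (- int n)"
    using c by (cases c) (auto simp: choice_set2_def split: if_splits)
  show "letter2 \<alpha> c i \<in> letters_at \<alpha> k i"
  proof (cases "i > 0")
    case True
    then have "k (int n) \<le> k i"
      using i pq(2) by (intro monotone_onD[OF k_mono(1)]) auto
    with True pq show ?thesis
      by (auto simp: letter2_def letters_at_def)
  next
    case False
    with i have "i < 0"
      by (auto simp: sgn_if split: if_splits)
    then have "k (- int n) \<le> k i"
      using i pq(2) monotone_onD[OF k_mono(2), of "int n" "- i"] by auto
    with \<open>i < 0\<close> pq show ?thesis
      by (auto simp: letter2_def letters_at_def)
  qed
qed (use variable in \<open>auto simp: choice_set2_def\<close>)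

lemma word_substitution1:
  assumes k_pos: "\<forall>n. n \<noteq> 0 \<longrightarrow> k n \<ge> 1"
    and k_mono: "mono_on {1..} k"
    and variable: "\<upsilon> \<notin> alphabet \<alpha>"
  shows "word_substitution \<alpha> k \<upsilon> (\<lambda>p _. \<alpha> (int p)) (choice_set1 k) {1}"
proof
  show "mono (choice_set1 k)"
  proof (rule monoI)
    fix m n :: nat assume "m \<le> n"
    then show "choice_set1 k m \<subseteq> choice_set1 k n"
      using monotone_onD[OF k_mono, of "int m" "int n"] by (auto simp: choice_set1_def)
  qed
  show "choice_set1 k 1 \<noteq> {}"
    using k_pos by (auto simp: choice_set1_def)
  fix p n i assume p: "p \<in> choice_set1 k n" and i: "int n \<le> \<bar>i\<bar>" "sgn i \<in> {1 :: int}"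
  have "i > 0"
    using i by (auto simp: sgn_if split: if_splits)
  moreover have pn: "n \<noteq> 0" "1 \<le> p" "p \<le> k (int n)"
    using p by (auto simp: choice_set1_def split: if_splits)
  moreover have "k (int n) \<le> k i"
    using i pn \<open>i > 0\<close> by (intro monotone_onD[OF k_mono]) auto
  ultimately show "\<alpha> (int p) \<in> letters_at \<alpha> k i"
    by (auto simp: letters_at_def)
qed (use variable in \<open>auto simp: choice_set1_def\<close>)

text \<open>The sets in \<open>less_R1\<close> are not said to be the negative and positive parts of
  the domain. They are forced to be, since \<open>v\<close> has positions of both signs: one set
  lies below a negative position, the other above a positive one.\<close>

lemma less_R1_iff_precedes:
  assumes v: "finite (dom v)" "dom_neg v \<noteq> {}" "dom_pos v \<noteq> {}"
    and w: "finite (dom w)" "0 \<notin> dom w" "dom_neg w \<noteq> {}" "dom_pos w \<noteq> {}"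
  shows "less_R1 v w \<longleftrightarrow> precedes v w"
proof
  obtain a b where ab: "a \<in> dom v" "a < 0" "b \<in> dom v" "0 < b"
    using v(2,3) by (auto simp: dom_neg_def dom_pos_def)
  assume "less_R1 v w"
  then obtain A1 A2 where A: "dom w = A1 \<union> A2" "A1 \<noteq> {}" "A2 \<noteq> {}"
    "Max A1 < Min (dom v)" "Max (dom v) < Min A2"
    by (auto simp: less_R1_def)
  have fin: "finite A1" "finite A2"
    using w(1) unfolding A(1) by simp_all
  have lt: "j < i" if "j \<in> A1" "i \<in> dom v" for i j
    using Max_ge[OF fin(1) that(1)] Min_le[OF v(1) that(2)] A(4) by linarith
  have gt: "i < j" if "j \<in> A2" "i \<in> dom v" for i j
    using Min_le[OF fin(2) that(1)] Max_ge[OF v(1) that(2)] A(5) by linarith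
  show "precedes v w"
    unfolding precedes_def
  proof (intro ballI)
    fix i j assume i: "i \<in> dom v" and "j \<in> dom w"
    then consider "j \<in> A1" | "j \<in> A2"
      using A(1) by blast
    then show "if 0 < j then i < j else j < i"
    proof cases
      case 1
      then show ?thesis
        using lt[OF 1 i] lt[OF 1 ab(1)] ab(2) by simp
    next
      case 2
      then show ?thesis
        using gt[OF 2 i] gt[OF 2 ab(3)] ab(4) by simp
    qed
  qed
next
  assume *: "precedes v w"
  have ne: "dom v \<noteq> {}"
    using v(2) by (auto simp: dom_neg_def)
  have "dom w = dom_neg w \<union> dom_pos w"
    using w(2) by (force simp: dom_neg_def dom_pos_def)
  moreover have "Max (dom_neg w) < Min (dom v)"
  proof -
    have "finite (dom_neg w)"
      using w(1) by (simp add: dom_neg_def)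
    then have "Max (dom_neg w) \<in> dom_neg w"
      using w(3) by (rule Max_in)
    moreover have "Min (dom v) \<in> dom v"
      using v(1) ne by (rule Min_in)
    ultimately show ?thesis
      using * unfolding precedes_def dom_neg_def by (metis (no_types, lifting) mem_Collect_eq not_less_iff_gr_or_eq)
  qed
  moreover have "Max (dom v) < Min (dom_pos w)"
  proof -
    have "finite (dom_pos w)"
      using w(1) by (simp add: dom_pos_def)
    then have "Min (dom_pos w) \<in> dom_pos w"
      using w(4) by (rule Min_in)
    moreover have "Max (dom v) \<in> dom v"
      using v(1) ne by (rule Max_in)
    ultimately show ?thesis
      using * unfolding precedes_def dom_pos_def by (metis (no_types, lifting) mem_Collect_eq)
  qed
  moreover have "Min (dom v) \<le> Max (dom v)"
    using v(1) ne by (meson Max_ge Min_in)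
  ultimately show "less_R1 v w"
    using w(3,4) unfolding less_R1_def by blast
qed

lemma less_R2_iff_precedes:
  assumes "finite (dom v)" "dom v \<noteq> {}" "finite (dom w)" "dom w \<noteq> {}" "dom w \<subseteq> {1..}"
  shows "less_R2 v w \<longleftrightarrow> precedes v w"
proof -
  have "\<forall>j\<in>dom w. 0 < j"
    using assms(5) by force
  moreover have "less_R2 v w \<longleftrightarrow> (\<forall>i\<in>dom v. \<forall>j\<in>dom w. i < j)"
    unfolding less_R2_def Max_less_iff[OF assms(1,2)] Min_gr_iff[OF assms(3,4)] by blast
  ultimately show ?thesis
    unfolding precedes_def by simp
qed

text \<open>The minimum in the definition bounds every positive position from below, which is the
  form of tail established for the extraction.\<close>

lemma R1_limI:
  assumes "x0 \<in> topspace T" "\<And>v. v \<in> W \<Longrightarrow> finite (dom v)"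
    and "\<forall>U. openin T U \<and> x0 \<in> U \<longrightarrow>
      (\<exists>n0::nat. n0 \<ge> 1 \<and> (\<forall>v\<in>W. (\<forall>i\<in>dom v. 0 < i \<longrightarrow> int n0 \<le> i) \<longrightarrow> x v \<in> U))"
  shows "R1_lim T W x x0"
  unfolding R1_lim_def
proof (intro conjI allI impI)
  fix V assume "nbhd T x0 V"
  then obtain U where U: "openin T U" "x0 \<in> U" "U \<subseteq> V"
    by (auto simp: nbhd_def)
  then obtain n0 :: nat where n0: "n0 \<ge> 1"
    "\<forall>v\<in>W. (\<forall>i\<in>dom v. 0 < i \<longrightarrow> int n0 \<le> i) \<longrightarrow> x v \<in> U"
    using assms(3) by blast
  have "x v \<in> V" if v: "v \<in> W" "min (- Max (dom_neg v)) (Min (dom_pos v)) \<ge> int n0" for v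
  proof -
    have "finite (dom_pos v)"
      using assms(2)[OF v(1)] by (simp add: dom_pos_def)
    then have "Min (dom_pos v) \<le> i" if "i \<in> dom v" "0 < i" for i
      using that by (intro Min_le) (simp_all add: dom_pos_def)
    then have "int n0 \<le> i" if "i \<in> dom v" "0 < i" for i
      using v(2) that by fastforce
    then show ?thesis
      using n0(2) v(1) U(3) by blast
  qed
  with n0(1) show "\<exists>n0::nat. n0 \<ge> 1 \<and>
      (\<forall>v\<in>W. min (- Max (dom_neg v)) (Min (dom_pos v)) \<ge> int n0 \<longrightarrow> x v \<in> V)"
    by blast
qed (rule assms(1))

lemma R2_limI:
  assumes "x0 \<in> topspace T" "\<And>v. v \<in> W \<Longrightarrow> finite (dom v)"
    and "\<forall>U. openin T U \<and> x0 \<in> U \<longrightarrow>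
      (\<exists>n0::nat. n0 \<ge> 1 \<and> (\<forall>v\<in>W. (\<forall>i\<in>dom v. 0 < i \<longrightarrow> int n0 \<le> i) \<longrightarrow> x v \<in> U))"
  shows "R2_lim T W x x0"
  unfolding R2_lim_def
proof (intro conjI allI impI)
  fix V assume "nbhd T x0 V"
  then obtain U where U: "openin T U" "x0 \<in> U" "U \<subseteq> V"
    by (auto simp: nbhd_def)
  then obtain n0 :: nat where n0: "n0 \<ge> 1"
    "\<forall>v\<in>W. (\<forall>i\<in>dom v. 0 < i \<longrightarrow> int n0 \<le> i) \<longrightarrow> x v \<in> U"
    using assms(3) by blast
  have "x v \<in> V" if v: "v \<in> W" "Min (dom v) \<ge> int n0" for v
  proof -
    have "int n0 \<le> i" if "i \<in> dom v" for i
      using v(2) Min_le[OF assms(2)[OF v(1)] that] by linarith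
    then show ?thesis
      using n0(2) v(1) U(3) by blast
  qed
  with n0(1) show "\<exists>n0::nat. n0 \<ge> 1 \<and> (\<forall>v\<in>W. Min (dom v) \<ge> int n0 \<longrightarrow> x v \<in> V)"
    by blast
qed (rule assms(1))

section \<open>Transfer to two-sided and one-sided words\<close>

theorem two_sided_convergence:
  fixes X :: "'x set" and \<alpha> :: "int \<Rightarrow> 'a"
  assumes metric: "Metric_space X d"
    and compact: "compact_space (Metric_space.mtopology X d)"
    and k_pos: "\<forall>n. n \<noteq> 0 \<longrightarrow> k n \<ge> 1"
    and k_mono: "mono_on {1..} k"
    and k_mono_neg: "mono_on {1..} (\<lambda>n. k (- n))"
    and variable: "\<upsilon> \<notin> alphabet \<alpha>"
    and w: "w \<in> seqs2 \<alpha> k \<upsilon>" and x: "x \<in> words2 \<alpha> k \<rightarrow> X"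
  shows "\<exists>u. \<exists>x0\<in>X. extraction2 \<alpha> k \<upsilon> u w \<and>
    R1_lim (Metric_space.mtopology X d) (E2 \<alpha> k \<upsilon> u) x x0"
proof -
  interpret word_substitution \<alpha> k \<upsilon> "letter2 \<alpha>" "choice_set2 k" "{-1, 1}"
    by (rule word_substitution2[OF k_pos k_mono k_mono_neg variable])
  have subst_eq: "subst2 \<alpha> \<upsilon> v c = subst v c" for v c
    by (auto simp: subst2_def subst_def letter2_def fun_eq_iff split: option.splits)
  \<comment> \<open>The two sides can differ only at index \<open>0\<close>, which \<open>E2\<close>
    and \<open>EV2\<close> exclude.\<close>
  have "choices2 k n = Some ` choice_set2 k n" if "n \<ge> 1" for n
    using that by (simp add: choices2_def choice_set2_def)
  then have choices_eq: "n \<ge> 1 \<and> c \<in> choices2 k n \<longleftrightarrow> n \<ge> 1 \<and> c \<in> Some ` choice_set2 k n"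
    "n \<ge> 1 \<and> c \<in> choices2 k n \<union> {None} \<longleftrightarrow> n \<ge> 1 \<and> c \<in> Some ` choice_set2 k n \<union> {None}" for n c
    by blast+
  have sgn_nz: "sgn i \<in> {-1, 1}" if "i \<noteq> 0" for i :: int
    using that by (auto simp: sgn_if)
  have var_word_eq: "var_word v \<longleftrightarrow> v \<in> var_words2 \<alpha> k \<upsilon>" for v
  proof -
    have "sgn ` dom v \<subseteq> {-1, 1}" if "v \<in> var_words \<alpha> k \<upsilon>"
    proof (rule image_subsetI)
      fix i assume "i \<in> dom v"
      moreover have "0 \<notin> dom v"
        using that by (simp add: var_words_def)
      ultimately show "sgn i \<in> {-1, 1}"
        using sgn_nz by metis
    qed
    moreover have "1 \<in> sgn ` {i. v i = Some \<upsilon>} \<longleftrightarrow> (\<exists>i\<in>dom_pos v. v i = Some \<upsilon>)"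
      by (force simp: dom_pos_def image_iff sgn_if split: if_splits)
    moreover have "- 1 \<in> sgn ` {i. v i = Some \<upsilon>} \<longleftrightarrow> (\<exists>i\<in>dom_neg v. v i = Some \<upsilon>)"
      by (force simp: dom_neg_def image_iff sgn_if split: if_splits)
    ultimately show ?thesis
      unfolding var_word_def var_words2_def by blast
  qed
  have less_eq: "less_R1 v v' \<longleftrightarrow> precedes v v'"
    if "v \<in> var_words2 \<alpha> k \<upsilon>" "v' \<in> var_words2 \<alpha> k \<upsilon>" for v v'
    using that by (intro less_R1_iff_precedes) (auto simp: var_words2_def var_words_def)
  have seqs_eq: "seqs2 \<alpha> k \<upsilon> = seqs"
    unfolding seqs2_def seqs_def var_word_eq
  proof (rule Collect_cong)
    fix u :: "nat \<Rightarrow> 'a word"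
    show "(\<forall>n\<ge>1. u n \<in> var_words2 \<alpha> k \<upsilon> \<and> less_R1 (u n) (u (Suc n))) \<longleftrightarrow>
        (\<forall>n\<ge>1. u n \<in> var_words2 \<alpha> k \<upsilon> \<and> precedes (u n) (u (Suc n)))"
    proof (cases "\<forall>n\<ge>1. u n \<in> var_words2 \<alpha> k \<upsilon>")
      case True
      then have "less_R1 (u n) (u (Suc n)) \<longleftrightarrow> precedes (u n) (u (Suc n))" if "n \<ge> 1" for n
        using that by (intro less_eq) simp_all
      with True show ?thesis
        by simp
    qed blast
  qed
  have E_eq: "E2 \<alpha> k \<upsilon> u = E u" for u
    by (simp only: E2_def E_def subst_eq choices_eq)
  have EV_eq: "EV2 \<alpha> k \<upsilon> u = EV u" for u
    by (simp only: EV2_def EV_def subst_eq choices_eq)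
  have "words \<subseteq> words2 \<alpha> k"
    by (auto simp: words_def)
  then have xW: "x \<in> words \<rightarrow> X"
    using x by blast
  have wS: "w \<in> seqs"
    using w seqs_eq by simp
  obtain u x0 where x0: "x0 \<in> X" and u: "u \<in> seqs" "\<forall>n\<ge>1. u n \<in> EV w"
    and lim: "\<forall>U. openin (Metric_space.mtopology X d) U \<and> x0 \<in> U \<longrightarrow>
      (\<exists>n0::nat. n0 \<ge> 1 \<and> (\<forall>v\<in>E u. (\<forall>i\<in>dom v. 0 < i \<longrightarrow> int n0 \<le> i) \<longrightarrow> x v \<in> U))"
    using convergent_extraction[OF wS metric compact xW] by (elim exE bexE conjE)
  have "R1_lim (Metric_space.mtopology X d) (E u) x x0"
    using x0 E_finite[OF u(1)] lim by (intro R1_limI) (simp_all add: Metric_space.topspace_mtopology[OF metric])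
  with x0 u show ?thesis
    unfolding extraction2_def E_eq EV_eq seqs_eq by blast
qed

theorem one_sided_convergence:
  fixes X :: "'x set" and \<alpha> :: "int \<Rightarrow> 'a"
  assumes metric: "Metric_space X d"
    and compact: "compact_space (Metric_space.mtopology X d)"
    and k_pos: "\<forall>n. n \<noteq> 0 \<longrightarrow> k n \<ge> 1"
    and k_mono: "mono_on {1..} k"
    and variable: "\<upsilon> \<notin> alphabet \<alpha>"
    and w: "w \<in> seqs1 \<alpha> k \<upsilon>" and x: "x \<in> words1 \<alpha> k \<rightarrow> X"
  shows "\<exists>u. \<exists>x0\<in>X. extraction1 \<alpha> k \<upsilon> u w \<and>
    R2_lim (Metric_space.mtopology X d) (E1 \<alpha> k \<upsilon> u) x x0"
proof -
  interpret word_substitution \<alpha> k \<upsilon> "\<lambda>p _. \<alpha> (int p)" "choice_set1 k" "{1}"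
    by (rule word_substitution1[OF k_pos k_mono variable])
  have subst_eq: "subst1 \<alpha> \<upsilon> v c = subst v c" for v c
    by (simp add: subst1_def subst_def)
  have "choices1 k n = Some ` choice_set1 k n" if "n \<ge> 1" for n
    using that by (simp add: choices1_def choice_set1_def)
  then have choices_eq: "n \<ge> 1 \<and> c \<in> choices1 k n \<longleftrightarrow> n \<ge> 1 \<and> c \<in> Some ` choice_set1 k n"
    "n \<ge> 1 \<and> c \<in> choices1 k n \<union> {None} \<longleftrightarrow> n \<ge> 1 \<and> c \<in> Some ` choice_set1 k n \<union> {None}" for n c
    by blast+
  have sgn_eq: "sgn ` D \<subseteq> {1} \<longleftrightarrow> D \<subseteq> {1..}" for D :: "int set"
    by (force simp: sgn_if split: if_splits)
  have var_word_eq: "var_word v \<longleftrightarrow> v \<in> var_words1 \<alpha> k \<upsilon>" for v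
  proof -
    have "{1} \<subseteq> sgn ` {i. v i = Some \<upsilon>}" if v: "v \<in> var_words \<alpha> k \<upsilon>" "sgn ` dom v \<subseteq> {1}"
    proof -
      obtain i where "i \<in> dom v" "v i = Some \<upsilon>"
        using v(1) by (auto simp: var_words_def)
      moreover from this have "sgn i = 1"
        using v(2) by blast
      ultimately show ?thesis
        by force
    qed
    then show ?thesis
      unfolding var_word_def var_words1_def using sgn_eq[of "dom v"] by blast
  qed
  have less_eq: "less_R2 v v' \<longleftrightarrow> precedes v v'"
    if "v \<in> var_words1 \<alpha> k \<upsilon>" "v' \<in> var_words1 \<alpha> k \<upsilon>" for v v'
    using that by (intro less_R2_iff_precedes) (auto simp: var_words1_def var_words_def)
  have seqs_eq: "seqs1 \<alpha> k \<upsilon> = seqs"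
    unfolding seqs1_def seqs_def var_word_eq
  proof (rule Collect_cong)
    fix u :: "nat \<Rightarrow> 'a word"
    show "(\<forall>n\<ge>1. u n \<in> var_words1 \<alpha> k \<upsilon> \<and> less_R2 (u n) (u (Suc n))) \<longleftrightarrow>
        (\<forall>n\<ge>1. u n \<in> var_words1 \<alpha> k \<upsilon> \<and> precedes (u n) (u (Suc n)))"
    proof (cases "\<forall>n\<ge>1. u n \<in> var_words1 \<alpha> k \<upsilon>")
      case True
      then have "less_R2 (u n) (u (Suc n)) \<longleftrightarrow> precedes (u n) (u (Suc n))" if "n \<ge> 1" for n
        using that by (intro less_eq) simp_all
      with True show ?thesis
        by simp
    qed blast
  qed
  have E_eq: "E1 \<alpha> k \<upsilon> u = E u" for u
    by (simp only: E1_def E_def subst_eq choices_eq)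
  have EV_eq: "EV1 \<alpha> k \<upsilon> u = EV u" for u
    by (simp only: EV1_def EV_def subst_eq choices_eq)
  have "words = words1 \<alpha> k"
    by (auto simp only: words_def words1_def sgn_eq)
  then have xW: "x \<in> words \<rightarrow> X"
    using x by simp
  have wS: "w \<in> seqs"
    using w seqs_eq by simp
  obtain u x0 where x0: "x0 \<in> X" and u: "u \<in> seqs" "\<forall>n\<ge>1. u n \<in> EV w"
    and lim: "\<forall>U. openin (Metric_space.mtopology X d) U \<and> x0 \<in> U \<longrightarrow>
      (\<exists>n0::nat. n0 \<ge> 1 \<and> (\<forall>v\<in>E u. (\<forall>i\<in>dom v. 0 < i \<longrightarrow> int n0 \<le> i) \<longrightarrow> x v \<in> U))"
    using convergent_extraction[OF wS metric compact xW] by (elim exE bexE conjE)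
  have "R2_lim (Metric_space.mtopology X d) (E u) x x0"
    using x0 E_finite[OF u(1)] lim by (intro R2_limI) (simp_all add: Metric_space.topspace_mtopology[OF metric])
  with x0 u show ?thesis
    unfolding extraction1_def E_eq EV_eq seqs_eq by blast
qed

theorem theorem2p1:
  fixes X :: "'x set" and d :: "'x \<Rightarrow> 'x \<Rightarrow> real"
    and \<alpha> :: "int \<Rightarrow> 'a" and k :: "int \<Rightarrow> nat" and \<upsilon> :: 'a
  assumes metric: "Metric_space X d"
    and compact: "compact_space (Metric_space.mtopology X d)"
    and k_pos: "\<forall>n. n \<noteq> 0 \<longrightarrow> k n \<ge> 1"
    and k_mono: "mono_on {1..} k"
    and k_mono_neg: "mono_on {1..} (\<lambda>n. k (- n))"
    and variable: "\<upsilon> \<notin> alphabet \<alpha>"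
  shows "(\<forall>w \<in> seqs2 \<alpha> k \<upsilon>. \<forall>x \<in> words2 \<alpha> k \<rightarrow> X.
            \<exists>u. \<exists>x0\<in>X. extraction2 \<alpha> k \<upsilon> u w \<and>
              R1_lim (Metric_space.mtopology X d) (E2 \<alpha> k \<upsilon> u) x x0)
       \<and> (\<forall>w \<in> seqs1 \<alpha> k \<upsilon>. \<forall>x \<in> words1 \<alpha> k \<rightarrow> X.
            \<exists>u. \<exists>x0\<in>X. extraction1 \<alpha> k \<upsilon> u w \<and>
              R2_lim (Metric_space.mtopology X d) (E1 \<alpha> k \<upsilon> u) x x0)"
  using two_sided_convergence[OF metric compact k_pos k_mono k_mono_neg variable]
    one_sided_convergence[OF metric compact k_pos k_mono variable]
  by simp

end
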